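(* Let $(M;c)$ be a connected, modular coloured matroid with no rainbow triangle. If $r(M)\ge2$ and $|c|\ge3$, then $(M;c)$ has a nonempty decomposer.
   Context: A coloured matroid $(M;c)$ is a (finite) matroid $M$ with a function $c$ on $E(M)$; $|c|$ is the number of colours used. $M$ is modular if $r_M(F)+r_M(F')=r_M(F\cup F')+r_M(F\cap F')$ for all flats $F,F'$. A rainbow triangle is a three-element circuit on which $c$ is injective. A decomposer of $(M;c)$ is a proper flat $F$ of $M$ such that for every $e\in E(M)-F$, the set $\mathrm{cl}_M(F\cup\{e\})-F$ is monochromatic under $c$. *)

theory Defs
  imports Main
begin

locale matroid =
  fixes E :: "'a set"
    and indep :: "'a set \<Rightarrow> bool"
  assumes finite_ground: "finite E"
    and indep_subset_ground: "indep I \<Longrightarrow> I \<subseteq> E"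
    and indep_empty: "indep {}"
    and indep_subset: "indep J \<Longrightarrow> I \<subseteq> J \<Longrightarrow> indep I"
    and augment: "indep I \<Longrightarrow> indep J \<Longrightarrow> card I < card J \<Longrightarrow> \<exists>e\<in>J - I. indep (insert e I)"
begin

definition rank :: "'a set \<Rightarrow> nat" where
  "rank X = Max (card ` {I. I \<subseteq> X \<and> indep I})"

definition cl :: "'a set \<Rightarrow> 'a set" where
  "cl X = {e \<in> E. rank (insert e X) = rank X}"

definition flat :: "'a set \<Rightarrow> bool" where
  "flat F \<longleftrightarrow> F \<subseteq> E \<and> cl F = F"

definition circuit :: "'a set \<Rightarrow> bool" where
  "circuit C \<longleftrightarrow> C \<subseteq> E \<and> \<not> indep C \<and> (\<forall>D. D \<subset> C \<longrightarrow> indep D)"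

definition connected :: bool where
  "connected \<longleftrightarrow> (\<forall>e\<in>E. \<forall>f\<in>E. e \<noteq> f \<longrightarrow> (\<exists>C. circuit C \<and> e \<in> C \<and> f \<in> C))"

definition modular :: bool where
  "modular \<longleftrightarrow>
    (\<forall>F F'. flat F \<longrightarrow> flat F' \<longrightarrow> rank F + rank F' = rank (F \<union> F') + rank (F \<inter> F'))"

text \<open>
  A colouring is a total function \<open>c\<close> on the element type; every notion below
  only inspects its values on \<open>E\<close>.
\<close>

definition num_colours :: "('a \<Rightarrow> 'c) \<Rightarrow> nat" where
  "num_colours c = card (c ` E)"

definition rainbow_triangle :: "('a \<Rightarrow> 'c) \<Rightarrow> 'a set \<Rightarrow> bool" where
  "rainbow_triangle c T \<longleftrightarrow> circuit T \<and> card T = 3 \<and> inj_on c T"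

definition monochromatic :: "('a \<Rightarrow> 'c) \<Rightarrow> 'a set \<Rightarrow> bool" where
  "monochromatic c X \<longleftrightarrow> (\<forall>x\<in>X. \<forall>y\<in>X. c x = c y)"

definition decomposer :: "('a \<Rightarrow> 'c) \<Rightarrow> 'a set \<Rightarrow> bool" where
  "decomposer c F \<longleftrightarrow>
    flat F \<and> F \<noteq> E \<and> (\<forall>e\<in>E - F. monochromatic c (cl (insert e F) - F))"

end

end

theory Submission
  imports Defs
begin

text \<open>
  Idea. Modularity and connectedness make the rank-one flats the points of a finite projective
  geometry whose lines have at least three points. If the elements of one colour span a proper
  flat \<open>F\<close>, then \<open>F\<close> is a decomposer: this is immediate for lines through an element of that
  colour, and the property passes to spans by Veblen's axiom. So it suffices to show that three
  colours cannot all be spanning.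

  In the plane this is a count. For \<open>a\<^sub>x\<^sub>y\<close> the number of \<open>x\<close>-points on a line with colours
  \<open>x\<close>, \<open>y\<close>, projecting from a point of the third colour shows that \<open>a\<^sub>x\<^sub>y\<close> does not depend on the
  line. Counting class 1 from a point of class 3 and from one of its own points gives
  \<open>(a\<^sub>1\<^sub>2 - a\<^sub>3\<^sub>2) (a\<^sub>1\<^sub>3 - a\<^sub>2\<^sub>3) = (a\<^sub>2\<^sub>3 - 1) (a\<^sub>3\<^sub>2 - 1) > 0\<close>, and the three cyclic versions
  have incompatible signs. Finiteness is essential: in infinite planes over valued fields Monsky's
  colouring is a counterexample.

  In higher rank, by induction some colour \<open>i\<close> spans only \<open>F\<close> inside a hyperplane \<open>H\<close>. Off \<open>H\<close>,
  modulo \<open>F\<close>, the elements of colour \<open>k\<close> are invariant under translation in every direction of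
  colour \<open>j\<close> determined by two elements of colour \<open>i\<close>, and vice versa. These directions
  generate \<open>H\<close>, so an element of colour \<open>j\<close> and one of colour \<open>k\<close> can be moved to a common element.
\<close>

section \<open>Rank and closure in matroids\<close>

context matroid
begin

lemma indep_finite: "indep I \<Longrightarrow> finite I"
  using finite_ground finite_subset indep_subset_ground by blast

lemma rank_set_finite: "finite (card ` {I. I \<subseteq> X \<and> indep I})"
proof -
  have "{I. I \<subseteq> X \<and> indep I} \<subseteq> Pow E"
    using indep_subset_ground by auto
  then show ?thesis
    by (simp add: finite_ground finite_subset)
qed

lemma card_le_rank: "I \<subseteq> X \<Longrightarrow> indep I \<Longrightarrow> card I \<le> rank X"
  unfolding rank_def by (rule Max_ge[OF rank_set_finite]) auto

lemma basis_exists: obtains B where "B \<subseteq> X" "indep B" "card B = rank X"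
proof -
  have "rank X \<in> card ` {I. I \<subseteq> X \<and> indep I}"
    unfolding rank_def using indep_empty by (intro Max_in[OF rank_set_finite]) auto
  then show ?thesis using that by auto
qed

lemma basis_extends:
  assumes "indep I" "I \<subseteq> X"
  obtains B where "I \<subseteq> B" "B \<subseteq> X" "indep B" "card B = rank X"
proof -
  have "\<exists>B. I \<subseteq> B \<and> B \<subseteq> X \<and> indep B \<and> card B = rank X"
    using assms
  proof (induction "rank X - card I" arbitrary: I)
    case 0
    then show ?case using card_le_rank[of I X] by auto
  next
    case (Suc n)
    obtain J where J: "J \<subseteq> X" "indep J" "card J = rank X" by (rule basis_exists)
    with Suc.hyps(2) obtain e where e: "e \<in> J - I" "indep (insert e I)"
      using augment[of I J] Suc.prems by fastforce
    have "n = rank X - card (insert e I)"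
      using Suc.hyps(2) e indep_finite[OF Suc.prems(1)] by simp
    then obtain B where "insert e I \<subseteq> B" "B \<subseteq> X" "indep B" "card B = rank X"
      using Suc.hyps(1)[of "insert e I"] e J Suc.prems by blast
    then show ?case by blast
  qed
  then show ?thesis using that by blast
qed

lemma rank_mono:
  assumes "X \<subseteq> Y"
  shows "rank X \<le> rank Y"
proof -
  obtain B where B: "B \<subseteq> X" "indep B" "card B = rank X" by (rule basis_exists)
  then show ?thesis using card_le_rank[of B Y] assms by auto
qed

text \<open>Closures can be computed from any single basis of the set. Idempotence, monotonicity and
  exchange then reduce to extending bases.\<close>

lemma mem_cl_iff_basis:
  assumes "B \<subseteq> X" "indep B" "card B = rank X" "e \<in> E"
  shows "e \<in> cl X \<longleftrightarrow> e \<in> B \<or> \<not> indep (insert e B)"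
proof
  assume "e \<in> cl X"
  then have "rank (insert e X) = card B" using assms by (simp add: cl_def)
  moreover have "card (insert e B) \<le> rank (insert e X)" if "indep (insert e B)"
    using that assms by (intro card_le_rank) auto
  ultimately show "e \<in> B \<or> \<not> indep (insert e B)"
    using indep_finite[OF assms(2)] by fastforce
next
  assume R: "e \<in> B \<or> \<not> indep (insert e B)"
  obtain J where J: "B \<subseteq> J" "J \<subseteq> insert e X" "indep J" "card J = rank (insert e X)"
    using basis_extends[of B "insert e X"] assms by blast
  have "J \<subseteq> X"
  proof (rule ccontr)
    assume "\<not> J \<subseteq> X"
    then have "e \<in> J" "e \<notin> X" using J by auto
    then have "indep (insert e B)" using J indep_subset[of J "insert e B"] by auto
    then show False using R \<open>e \<notin> X\<close> assms by auto
  qed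
  then have "rank (insert e X) \<le> rank X" using J card_le_rank by metis
  then show "e \<in> cl X"
    using rank_mono[OF subset_insertI] assms by (simp add: cl_def le_antisym)
qed

lemma cl_ground: "cl X \<subseteq> E"
  by (auto simp: cl_def)

lemma subset_cl: "X \<subseteq> E \<Longrightarrow> X \<subseteq> cl X"
  by (auto simp: cl_def insert_absorb)

text \<open>Extend \<open>B\<close> to a basis of \<open>cl X\<close>. An added element would lie in
  \<open>cl X\<close> and yet be independent over \<open>B\<close>, so nothing is added.\<close>

lemma basis_of_cl:
  assumes "X \<subseteq> E" "B \<subseteq> X" "indep B" "card B = rank X"
  shows "card B = rank (cl X)"
proof -
  obtain J where J: "B \<subseteq> J" "J \<subseteq> cl X" "indep J" "card J = rank (cl X)"
    using basis_extends[of B "cl X"] assms subset_cl[of X] by blast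
  have "J \<subseteq> B"
  proof
    fix e assume e: "e \<in> J"
    then have "e \<in> cl X" "e \<in> E" using J cl_ground by auto
    moreover have "indep (insert e B)" using J e indep_subset[of J "insert e B"] by auto
    ultimately show "e \<in> B" using mem_cl_iff_basis[of B X e] assms by blast
  qed
  then show ?thesis using J by auto
qed

lemma rank_cl: "X \<subseteq> E \<Longrightarrow> rank (cl X) = rank X"
  using basis_exists[of X] basis_of_cl[of X] by metis

lemma cl_idem:
  assumes "X \<subseteq> E"
  shows "cl (cl X) = cl X"
proof -
  obtain B where B: "B \<subseteq> X" "indep B" "card B = rank X" by (rule basis_exists)
  have "B \<subseteq> cl X" "card B = rank (cl X)"
    using B basis_of_cl[OF assms B] subset_cl[OF assms] by auto
  then have "e \<in> cl (cl X) \<longleftrightarrow> e \<in> cl X" if "e \<in> E" for e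
    using mem_cl_iff_basis[of B X e] mem_cl_iff_basis[of B "cl X" e] that B by simp
  then show ?thesis using cl_ground by blast
qed

lemma cl_mono:
  assumes "X \<subseteq> Y"
  shows "cl X \<subseteq> cl Y"
proof
  fix e assume e: "e \<in> cl X"
  then have "e \<in> E" using cl_ground by auto
  obtain B where B: "B \<subseteq> X" "indep B" "card B = rank X" by (rule basis_exists)
  obtain J where J: "B \<subseteq> J" "J \<subseteq> Y" "indep J" "card J = rank Y"
    using basis_extends[of B Y] B assms by blast
  have "e \<in> B \<or> \<not> indep (insert e B)" using e B \<open>e \<in> E\<close> mem_cl_iff_basis[of B X e] by blast
  then have "e \<in> J \<or> \<not> indep (insert e J)"
    using J indep_subset[of "insert e J" "insert e B"] by blast
  then show "e \<in> cl Y" using J \<open>e \<in> E\<close> mem_cl_iff_basis[of J Y e] by blast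
qed

lemma cl_subset_iff: "X \<subseteq> E \<Longrightarrow> Y \<subseteq> E \<Longrightarrow> cl X \<subseteq> cl Y \<longleftrightarrow> X \<subseteq> cl Y"
  using cl_idem[of Y] cl_mono[of X "cl Y"] subset_cl[of X] by blast

lemma basis_insert:
  assumes "B \<subseteq> X" "indep B" "card B = rank X" "e \<in> E - cl X"
  shows "indep (insert e B)" "card (insert e B) = rank (insert e X)" "rank (insert e X) = Suc (rank X)"
proof -
  have e: "e \<notin> B" "indep (insert e B)" using assms mem_cl_iff_basis[of B X e] by auto
  then show "indep (insert e B)" by simp
  obtain J where J: "insert e B \<subseteq> J" "J \<subseteq> insert e X" "indep J" "card J = rank (insert e X)"
    using basis_extends[of "insert e B" "insert e X"] assms(1) e by blast
  have "card (J - {e}) \<le> rank X" using J indep_subset by (intro card_le_rank) auto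
  moreover have "card J \<ge> card (insert e B)" using J indep_finite card_mono by blast
  moreover have "card (insert e B) = Suc (card B)" using e indep_finite[OF assms(2)] by simp
  moreover have "card (J - {e}) = card J - 1" using J by auto
  ultimately show "card (insert e B) = rank (insert e X)" "rank (insert e X) = Suc (rank X)"
    using J assms(3) by auto
qed

text \<open>When neither element lies in \<open>cl X\<close>, both memberships say that a basis of
  \<open>X\<close> becomes dependent on adding \<open>e\<close> and \<open>f\<close>, which is
  symmetric in the two.\<close>

lemma cl_exchange:
  assumes "e \<in> E" "f \<in> cl (insert e X)" "f \<notin> cl X"
  shows "e \<in> cl (insert f X)"
proof -
  obtain B where B: "B \<subseteq> X" "indep B" "card B = rank X" by (rule basis_exists)
  have f: "f \<in> E - cl X" using assms cl_ground by auto
  show ?thesis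
  proof (cases "e \<in> cl X")
    case True
    then show ?thesis using cl_mono[of X "insert f X"] by blast
  next
    case False
    then have e: "e \<in> E - cl X" using assms by auto
    have "f \<in> insert e B \<or> \<not> indep (insert f (insert e B))"
      using mem_cl_iff_basis[of "insert e B" "insert e X" f] basis_insert[OF B e] B assms f by auto
    then have "e \<in> insert f B \<or> \<not> indep (insert e (insert f B))"
      using mem_cl_iff_basis[OF B, of f] f by (auto simp: insert_commute)
    then show ?thesis
      using mem_cl_iff_basis[of "insert f B" "insert f X" e] basis_insert[OF B f] B e by auto
  qed
qed

lemma rank_insert: "e \<in> E \<Longrightarrow> e \<notin> cl X \<Longrightarrow> rank (insert e X) = Suc (rank X)"
  using basis_exists[of X] basis_insert(3)[of _ X e] by blast

lemma rank_empty: "rank {} = 0"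
  using basis_exists[of "{}"] by auto

lemma flat_cl: "X \<subseteq> E \<Longrightarrow> flat (cl X)"
  by (simp add: flat_def cl_ground cl_idem)

lemma flat_subset: "flat F \<Longrightarrow> F \<subseteq> E"
  by (simp add: flat_def)

lemma cl_subset_flat: "flat F \<Longrightarrow> X \<subseteq> F \<Longrightarrow> cl X \<subseteq> F"
  by (metis cl_mono flat_def)

lemma flat_cl_eq: "flat F \<Longrightarrow> cl F = F"
  by (simp add: flat_def)

text \<open>By exchange, a new element of \<open>H\<close> in the span would pull \<open>e\<close>
  into \<open>H\<close>. This is the tool for cutting a span back to a hyperplane.\<close>

lemma flat_Int_cl_insert:
  assumes "flat H" "X \<subseteq> H" "e \<in> E" "e \<notin> H"
  shows "H \<inter> cl (insert e X) \<subseteq> cl X"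
proof
  fix z assume z: "z \<in> H \<inter> cl (insert e X)"
  show "z \<in> cl X"
  proof (rule ccontr)
    assume "z \<notin> cl X"
    then have "e \<in> cl (insert z X)" using cl_exchange z assms by blast
    then show False using cl_subset_flat[of H "insert z X"] assms z by auto
  qed
qed

lemma card_eq_rank:
  assumes "indep I"
  shows "card I = rank I"
proof -
  obtain B where "I \<subseteq> B" "B \<subseteq> I" "indep B" "card B = rank I"
    by (rule basis_extends[OF assms subset_refl])
  then show ?thesis by auto
qed

lemma indep_not_cl:
  assumes "indep I" "e \<in> I"
  shows "e \<notin> cl (I - {e})"
proof -
  have "card (I - {e}) = rank (I - {e})"
    using assms(1) indep_subset by (intro card_eq_rank) auto
  then show ?thesis
    using mem_cl_iff_basis[of "I - {e}" "I - {e}" e] assms indep_subset[of I "I - {e}"]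
      indep_subset_ground by (auto simp: insert_absorb)
qed

lemma dependent_cl:
  assumes "indep I" "e \<in> E" "e \<notin> I" "\<not> indep (insert e I)"
  shows "e \<in> cl I"
proof -
  show ?thesis using mem_cl_iff_basis[of I I e] assms card_eq_rank by blast
qed

lemma indep_insert_cl:
  assumes "indep I" "e \<in> E" "e \<notin> cl I"
  shows "indep (insert e I)"
  by (metis assms dependent_cl insert_absorb)

end

section \<open>Connected modular matroids as projective geometries\<close>

locale connected_modular_matroid = matroid +
  assumes conn: connected
    and modular_axiom: modular
    and rank_ge_2: "2 \<le> rank E"
begin

text \<open>There are no loops: rank at least 2 provides a second element, and a circuit through
  both contains \<open>{e}\<close> properly.\<close>

lemma indep_singleton:
  assumes "e \<in> E"
  shows "indep {e}"
proof -
  have "E \<noteq> {e}"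
  proof
    assume "E = {e}"
    obtain B where "B \<subseteq> E" "card B = rank E" by (rule basis_exists)
    then show False
      using rank_ge_2 \<open>E = {e}\<close> card_mono[of "{e}" B] by simp
  qed
  then obtain f where "f \<in> E" "e \<noteq> f" using assms by blast
  then obtain C where C: "circuit C" "e \<in> C" "f \<in> C"
    using conn assms by (auto simp: connected_def)
  then have "{e} \<subset> C" using \<open>e \<noteq> f\<close> by auto
  then show ?thesis using C by (simp add: circuit_def)
qed

lemma cl_empty: "cl {} = {}"
proof -
  have "e \<notin> cl {}" if "e \<in> E" for e
    using indep_not_cl[OF indep_singleton[OF that], of e] by simp
  then show ?thesis using cl_ground by blast
qed

lemma flat_empty: "flat {}"
  by (simp add: flat_def cl_empty)

lemma mem_cl_singleton: "a \<in> E \<Longrightarrow> a \<in> cl {a}"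
  using subset_cl[of "{a}"] by simp

lemma mem_cl_pair: "a \<in> E \<Longrightarrow> b \<in> E \<Longrightarrow> a \<in> cl {a, b}" "a \<in> E \<Longrightarrow> b \<in> E \<Longrightarrow> b \<in> cl {a, b}"
  using subset_cl[of "{a, b}"] by simp_all

lemma cl_trans:
  assumes "x \<in> cl A" "A \<subseteq> cl B" "B \<subseteq> E"
  shows "x \<in> cl B"
  using assms cl_mono[of A "cl B"] cl_idem[of B] by auto

lemma in_ground: "x \<in> cl A \<Longrightarrow> x \<in> E"
  using cl_ground by blast

lemma cl_singleton_sym:
  assumes "a \<in> E" "x \<in> cl {a}"
  shows "a \<in> cl {x}"
  using cl_exchange[of a x "{}"] assms cl_empty by simp

lemma cl_singleton_eq:
  assumes "a \<in> E" "x \<in> cl {a}"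
  shows "cl {x} = cl {a}"
proof
  have "x \<in> E" using assms in_ground by blast
  show "cl {x} \<subseteq> cl {a}" using cl_trans[of _ "{x}" "{a}"] assms by auto
  show "cl {a} \<subseteq> cl {x}"
    using cl_trans[of _ "{a}" "{x}"] cl_singleton_sym assms \<open>x \<in> E\<close> by auto
qed

lemma cl_pair_exchange:
  assumes "x \<in> cl {a, b}" "x \<notin> cl {a}" "b \<in> E"
  shows "b \<in> cl {a, x}"
  using cl_exchange[of b x "{a}"] assms by (simp add: insert_commute)

lemma cl_pair_eq:
  assumes "x \<in> cl {a, b}" "x \<notin> cl {a}" "a \<in> E" "b \<in> E"
  shows "cl {a, x} = cl {a, b}"
proof
  have "x \<in> E" using assms in_ground by blast
  show "cl {a, x} \<subseteq> cl {a, b}"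
    using cl_trans[of _ "{a, x}" "{a, b}"] mem_cl_pair assms by auto
  show "cl {a, b} \<subseteq> cl {a, x}"
    using cl_trans[of _ "{a, b}" "{a, x}"] mem_cl_pair cl_pair_exchange assms \<open>x \<in> E\<close> by auto
qed

lemma in_flat_pair: "flat F \<Longrightarrow> a \<in> F \<Longrightarrow> b \<in> F \<Longrightarrow> x \<in> cl {a, b} \<Longrightarrow> x \<in> F"
  using cl_subset_flat[of F "{a, b}"] by auto

lemma in_flat_singleton: "flat F \<Longrightarrow> a \<in> F \<Longrightarrow> x \<in> cl {a} \<Longrightarrow> x \<in> F"
  using cl_subset_flat[of F "{a}"] by auto

lemma flat_pair_exchange:
  assumes "flat F" "a \<in> F" "x \<in> F" "x \<notin> cl {a}" "x \<in> cl {a, b}" "b \<in> E"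
  shows "b \<in> F"
  using cl_pair_exchange[of x a b] in_flat_pair[of F a x b] assms by blast

lemma rank_singleton:
  assumes "a \<in> E"
  shows "rank {a} = 1"
  using rank_insert[of a "{}"] assms cl_empty rank_empty by simp

lemma rank_pair:
  assumes "a \<in> E" "b \<in> E" "b \<notin> cl {a}"
  shows "rank {a, b} = 2"
  using rank_insert[of b "{a}"] assms rank_singleton[of a] by (simp add: insert_commute)

text \<open>All uses of modularity pass through this lemma. For \<open>x\<close> and
  \<open>y\<close> outside \<open>F\<close> and not parallel, the ranks of \<open>F\<close> and of
  the line \<open>?L\<close> sum to more than the rank of their union, so the two meet, and a common
  element serves as \<open>a\<close>.\<close>

lemma cl_insert_flat:
  assumes F: "flat F" "F \<noteq> {}" and "x \<in> E" "y \<in> cl (insert x F)"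
  obtains a where "a \<in> F" "y \<in> cl {a, x}"
proof -
  have FE: "F \<subseteq> E" using F by (simp add: flat_def)
  have yE: "y \<in> E" using assms in_ground by blast
  have "\<exists>a\<in>F. y \<in> cl {a, x}"
  proof (cases "y \<in> F \<or> y \<in> cl {x}")
    case True
    then show ?thesis
    proof
      assume "y \<in> F"
      then show ?thesis using mem_cl_pair yE assms by blast
    next
      assume "y \<in> cl {x}"
      then show ?thesis using cl_mono[of "{x}" "{a, x}" for a] F by blast
    qed
  next
    case False
    let ?L = "cl {x, y}"
    have xF: "x \<notin> F" using False assms F by (auto simp: insert_absorb flat_def)
    have LE: "{x, y} \<subseteq> E" using assms yE by auto
    have rL: "rank ?L = 2" using rank_pair[of x y] False assms yE rank_cl[OF LE] by simp
    have rFx: "rank (insert x F) = Suc (rank F)"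
      using rank_insert[of x F] xF assms F by (simp add: flat_def)
    have "F \<union> ?L \<subseteq> cl (insert x F)"
    proof -
      have "{x, y} \<subseteq> cl (insert x F)" using assms subset_cl[of "insert x F"] FE by auto
      then have "?L \<subseteq> cl (insert x F)"
        using cl_subset_iff[of "{x, y}" "insert x F"] LE FE assms by auto
      moreover have "F \<subseteq> cl (insert x F)" using subset_cl[of "insert x F"] FE assms by auto
      ultimately show ?thesis by auto
    qed
    then have "rank (F \<union> ?L) \<le> Suc (rank F)"
      using rank_mono[of "F \<union> ?L" "cl (insert x F)"] rank_cl[of "insert x F"] FE assms rFx by auto
    moreover have "rank F + rank ?L = rank (F \<union> ?L) + rank (F \<inter> ?L)"
      using modular_axiom F flat_cl[OF LE] by (auto simp: modular_def)
    ultimately have "rank (F \<inter> ?L) \<noteq> rank {}" using rL rank_empty by simp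
    then have "F \<inter> ?L \<noteq> {}" by metis
    then obtain a where a: "a \<in> F" "a \<in> ?L" by blast
    have "a \<notin> cl {x}" using a xF cl_singleton_sym[of x a] in_flat_singleton[of F a x] assms by blast
    then have "y \<in> cl {x, a}" using cl_pair_exchange[of a x y] a yE by blast
    then show ?thesis using a by (auto simp: insert_commute)
  qed
  then show ?thesis using that by blast
qed

text \<open>This is \<open>cl_insert_flat\<close> for the line through \<open>a\<close> and
  \<open>b\<close>: projection from \<open>x\<close> inside a plane.\<close>

lemma veblen:
  assumes "a \<in> E" "b \<in> E" "x \<in> E" "y \<in> cl {x, a, b}"
  obtains t where "t \<in> cl {a, b}" "y \<in> cl {t, x}"
proof -
  have ab: "{a, b} \<subseteq> E" using assms by auto
  have "y \<in> cl (insert x (cl {a, b}))"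
    using assms(4) cl_mono[of "{x, a, b}" "insert x (cl {a, b})"] subset_cl[OF ab] by auto
  moreover have "cl {a, b} \<noteq> {}" using mem_cl_pair assms by blast
  ultimately show ?thesis
    using cl_insert_flat[OF flat_cl[OF ab]] assms that by blast
qed

text \<open>Subspaces of a projective geometry are determined by lines: build the span one element
  at a time, each new element lying on a line to the earlier span. Sets defined by a property of
  lines are shown to be flats in this way.\<close>

lemma flat_if_line_closed:
  assumes "G \<subseteq> E" and closed: "\<And>x y z. x \<in> G \<Longrightarrow> y \<in> G \<Longrightarrow> z \<in> cl {x, y} \<Longrightarrow> z \<in> G"
  shows "flat G"
proof -
  have "cl S \<subseteq> G" if "finite S" "S \<subseteq> G" for S
    using that
  proof (induction S rule: finite_induct)
    case empty
    then show ?case by (simp add: cl_empty)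
  next
    case (insert x S)
    show ?case
    proof (cases "S = {}")
      case True
      then show ?thesis using closed[of x x] insert by auto
    next
      case False
      have SE: "S \<subseteq> E" "x \<in> E" using insert.prems assms(1) by auto
      show ?thesis
      proof
        fix y assume "y \<in> cl (insert x S)"
        then have "y \<in> cl (insert x (cl S))"
          using cl_mono[of "insert x S" "insert x (cl S)"] subset_cl[OF SE(1)] by auto
        moreover have "cl S \<noteq> {}" using subset_cl[OF SE(1)] False by auto
        ultimately obtain a where "a \<in> cl S" "y \<in> cl {a, x}"
          using cl_insert_flat[OF flat_cl[OF SE(1)]] SE by blast
        then show "y \<in> G" using closed[of a x y] insert.IH insert.prems by auto
      qed
    qed
  qed
  then have "cl G \<subseteq> G" using finite_subset[OF assms(1) finite_ground] by blast
  then show ?thesis using subset_cl[OF assms(1)] assms(1) by (auto simp: flat_def)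
qed

text \<open>The union \<open>W\<close> of all lines joining \<open>U\<close> to \<open>V\<close> is
  closed under lines, hence a flat, and it contains both.\<close>

lemma cl_Un_flats:
  assumes U: "flat U" "U \<noteq> {}" and V: "flat V" "V \<noteq> {}" and x: "x \<in> cl (U \<union> V)"
  obtains u v where "u \<in> U" "v \<in> V" "x \<in> cl {u, v}"
proof -
  define W where "W = {x. \<exists>u\<in>U. \<exists>v\<in>V. x \<in> cl {u, v}}"
  have E: "U \<subseteq> E" "V \<subseteq> E" using U V flat_subset by auto
  have "flat W"
  proof (rule flat_if_line_closed)
    show "W \<subseteq> E" using in_ground by (auto simp: W_def)
  next
    fix y z x assume "y \<in> W" "z \<in> W" and x: "x \<in> cl {y, z}"
    then obtain u v u' v' where uv: "u \<in> U" "v \<in> V" "u' \<in> U" "v' \<in> V" "y \<in> cl {u, v}" "z \<in> cl {u', v'}"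
      by (auto simp: W_def)
    have vE: "v \<in> E" "v' \<in> E" using uv E by auto
    have S: "insert v' U \<subseteq> E" "insert v (cl (insert v' U)) \<subseteq> E" using vE E cl_ground by auto
    let ?S = "insert v (cl (insert v' U))"
    have "insert v' U \<subseteq> ?S" using subset_cl[OF S(1)] by auto
    then have "{u, v} \<subseteq> ?S" "{u', v'} \<subseteq> ?S" using uv by auto
    then have "{y, z} \<subseteq> cl ?S" using uv cl_mono by blast
    then have "x \<in> cl ?S" using cl_trans[OF x _ S(2)] by blast
    moreover have "cl (insert v' U) \<noteq> {}" using subset_cl[OF S(1)] by auto
    ultimately obtain a where a: "a \<in> cl (insert v' U)" "x \<in> cl {a, v}"
      using cl_insert_flat[OF flat_cl[OF S(1)]] vE by blast
    obtain b where b: "b \<in> U" "a \<in> cl {b, v'}" using cl_insert_flat[OF U vE(2) a(1)] .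
    have bE: "b \<in> E" using b E by blast
    have T: "{b, v, v'} \<subseteq> E" using bE vE by auto
    have "{a, v} \<subseteq> cl {b, v, v'}"
      using b cl_mono[of "{b, v'}" "{b, v, v'}"] subset_cl[OF T] by blast
    then have "x \<in> cl {b, v, v'}" using cl_trans[OF a(2) _ T] by blast
    \<comment> \<open>Inside the span of \<open>b\<close>, \<open>v\<close>, \<open>v'\<close> the
      projection is now from \<open>b\<close>, so the other end \<open>t\<close> falls on the line
      through \<open>v\<close> and \<open>v'\<close>, which lies in \<open>V\<close>.\<close>
    then obtain t where t: "t \<in> cl {v, v'}" "x \<in> cl {t, b}" using veblen[OF vE bE] by blast
    have "t \<in> V" using in_flat_pair[OF V(1) uv(2,4) t(1)] .
    moreover have "x \<in> cl {b, t}" using t by (simp add: insert_commute)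
    ultimately show "x \<in> W" using b by (auto simp: W_def)
  qed
  moreover have "u \<in> cl {u, v}" "v \<in> cl {u, v}" if "u \<in> U" "v \<in> V" for u v
    using mem_cl_pair[of u v] that E by auto
  then have "U \<union> V \<subseteq> W" using U V by (fastforce simp: W_def)
  ultimately have "x \<in> W" using cl_subset_flat x by blast
  then show ?thesis using that by (auto simp: W_def)
qed

text \<open>This is where connectedness enters. A circuit \<open>C\<close> through \<open>x\<close>
  and \<open>y\<close> has further elements, and the flat they span meets the line through
  \<open>x\<close> and \<open>y\<close> in some \<open>a\<close>. Since \<open>C - {x}\<close> is
  independent, \<open>y\<close> is not in that flat, so \<open>a\<close> is not parallel to
  \<open>y\<close>; were it parallel to \<open>x\<close>, then \<open>y\<close> would be
  too.\<close>

lemma third_point: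
  assumes "x \<in> E" "y \<in> E" "y \<notin> cl {x}"
  obtains z where "z \<in> cl {x, y}" "z \<notin> cl {x}" "z \<notin> cl {y}"
proof -
  have "x \<noteq> y" using assms mem_cl_singleton by auto
  then obtain C where C: "circuit C" "x \<in> C" "y \<in> C"
    using conn assms by (auto simp: connected_def)
  have CE: "C \<subseteq> E" using C by (simp add: circuit_def)
  have sub: "indep D" if "D \<subset> C" for D using that C by (simp add: circuit_def)
  have "indep {x, y}"
    using indep_insert_cl[OF indep_singleton] assms by (metis insert_commute)
  then have "C \<noteq> {x, y}" using C by (auto simp: circuit_def)
  let ?A = "cl (C - {x, y})"
  have AE: "C - {x, y} \<subseteq> E" using CE by auto
  have A: "flat ?A" using flat_cl[OF AE] .
  have "C - {x, y} \<noteq> {}" using C \<open>C \<noteq> {x, y}\<close> by auto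
  then have An: "?A \<noteq> {}" using subset_cl[OF AE] by auto
  have "C - {y} \<subset> C" using C by auto
  have "y \<in> cl (C - {y})"
  proof (rule ccontr)
    assume "y \<notin> cl (C - {y})"
    then have "indep (insert y (C - {y}))"
      using indep_insert_cl[OF sub[OF \<open>C - {y} \<subset> C\<close>]] assms by blast
    then show False using C by (simp add: circuit_def insert_absorb)
  qed
  moreover have "C - {y} \<subseteq> insert x ?A" using subset_cl[OF AE] by auto
  ultimately have "y \<in> cl (insert x ?A)" using cl_mono by blast
  then obtain a where a: "a \<in> ?A" "y \<in> cl {a, x}"
    using cl_insert_flat[OF A An] assms by blast
  have aE: "a \<in> E" using a in_ground by blast
  have "indep (C - {x})" using sub[of "C - {x}"] C by auto
  then have yA: "y \<notin> ?A"
    using indep_not_cl[of "C - {x}" y] C \<open>x \<noteq> y\<close> by (simp add: Diff_insert2[symmetric] insert_commute)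
  have ax: "a \<notin> cl {x}"
  proof
    assume "a \<in> cl {x}"
    then have "{a, x} \<subseteq> cl {x}" using mem_cl_singleton assms by auto
    then show False using cl_trans[of y "{a, x}" "{x}"] a assms by auto
  qed
  have ay: "a \<notin> cl {y}"
    using cl_singleton_sym[of y a] in_flat_singleton[OF A a(1), of y] yA assms by blast
  have "y \<in> cl {x, a}" using a by (simp add: insert_commute)
  then have "a \<in> cl {x, y}" using cl_pair_exchange[of y x a] assms aE by blast
  then show ?thesis using that ax ay by blast
qed

lemma triangle:
  assumes "x \<in> E" "y \<in> E" "y \<notin> cl {x}" "z \<in> cl {x, y}" "z \<notin> cl {x}" "z \<notin> cl {y}"
  shows "circuit {x, y, z}" "card {x, y, z} = 3"
proof -
  have zE: "z \<in> E" using assms in_ground by blast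
  have ne: "x \<noteq> y" "x \<noteq> z" "y \<noteq> z" using assms mem_cl_singleton by auto
  then show "card {x, y, z} = 3" by simp
  have pair: "indep {a, b}" if "a \<in> E" "b \<in> E" "b \<notin> cl {a}" for a b
    using indep_insert_cl[OF indep_singleton] that by (metis insert_commute)
  have "indep {x, y}" "indep {x, z}" "indep {y, z}" using pair assms zE by auto
  moreover have "D \<subseteq> {x, y} \<or> D \<subseteq> {x, z} \<or> D \<subseteq> {y, z}" if "D \<subset> {x, y, z}" for D
    using that by auto
  ultimately have "indep D" if "D \<subset> {x, y, z}" for D using that indep_subset by meson
  moreover have "\<not> indep {x, y, z}"
  proof
    assume "indep {x, y, z}"
    then have "z \<notin> cl ({x, y, z} - {z})" using indep_not_cl by blast
    moreover have "{x, y, z} - {z} = {x, y}" using ne by auto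
    ultimately show False using assms by simp
  qed
  ultimately show "circuit {x, y, z}" using assms zE by (simp add: circuit_def)
qed

end

section \<open>Colourings without rainbow triangles\<close>

locale rainbow_free_matroid = connected_modular_matroid +
  fixes c :: "'a \<Rightarrow> 'c"
  assumes no_rainbow: "\<not> (\<exists>T. rainbow_triangle c T)"
begin

definition colour_class :: "'c \<Rightarrow> 'a set \<Rightarrow> 'a set" where
  "colour_class i X = {x \<in> X. c x = i}"

definition spans :: "'c \<Rightarrow> 'a set \<Rightarrow> bool" where
  "spans i X \<longleftrightarrow> cl (colour_class i X) = X"

lemma not_all_distinct:
  assumes "x \<in> E" "y \<in> E" "y \<notin> cl {x}" "z \<in> cl {x, y}" "z \<notin> cl {x}" "z \<notin> cl {y}"
  shows "c x = c y \<or> c x = c z \<or> c y = c z"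
proof (rule ccontr)
  assume "\<not> ?thesis"
  then have "inj_on c {x, y, z}" by auto
  then show False
    using no_rainbow triangle[OF assms] by (auto simp: rainbow_triangle_def)
qed

lemma colour_class_subset: "colour_class i X \<subseteq> X"
  by (auto simp: colour_class_def)

lemma flat_cl_colour_class: "flat X \<Longrightarrow> flat (cl (colour_class i X))"
  using flat_cl[of "colour_class i X"] colour_class_subset[of i X] flat_subset[of X] by blast

lemma cl_colour_class_subset: "flat X \<Longrightarrow> cl (colour_class i X) \<subseteq> X"
  using cl_subset_flat[of X "colour_class i X"] colour_class_subset[of i X] by blast

lemma mem_cl_colour_class:
  "flat X \<Longrightarrow> x \<in> X \<Longrightarrow> c x = i \<Longrightarrow> x \<in> cl (colour_class i X)"
  using subset_cl[of "colour_class i X"] colour_class_subset[of i X] flat_subset[of X]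
  by (auto simp: colour_class_def)

lemma spans_not_subset:
  assumes "spans i X" "flat F" "F \<subseteq> X" "F \<noteq> X"
  shows "\<exists>x\<in>X. c x = i \<and> x \<notin> F"
proof -
  have "\<not> colour_class i X \<subseteq> F"
    using assms cl_subset_flat[of F "colour_class i X"] by (auto simp: spans_def)
  then show ?thesis by (auto simp: colour_class_def)
qed

text \<open>The line meets \<open>F\<close> only in elements parallel to \<open>f\<close>, so the
  rest of it avoids colour \<open>i\<close>. Since \<open>f\<close> has colour \<open>i\<close>, two
  other points of the line cannot differ in colour without making a rainbow triangle.\<close>

lemma line_to_colour_class:
  assumes X: "flat X" and F: "flat F" "F = cl (colour_class i X)"
    and f: "f \<in> X" "c f = i" and e: "e \<in> X" "e \<notin> F" and g: "g \<in> cl {f, e}" "g \<notin> cl {f}"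
  shows "c g = c e"
proof -
  have XE: "X \<subseteq> E" using flat_subset[OF X] .
  have E: "f \<in> E" "e \<in> E" "g \<in> E" using f e g XE in_ground by auto
  have fF: "f \<in> F" using mem_cl_colour_class[OF X] f F by blast
  have efn: "e \<notin> cl {f}" using in_flat_singleton[OF F(1) fF] e by blast
  have line: "h \<in> X \<and> h \<notin> F \<and> c h \<noteq> i" if "h \<in> cl {f, e}" "h \<notin> cl {f}" for h
  proof (intro conjI)
    show "h \<in> X" using in_flat_pair[OF X f(1) e(1)] that by blast
    show "h \<notin> F" using flat_pair_exchange[OF F(1) fF _ that(2) that(1)] e E by blast
    then show "c h \<noteq> i" using \<open>h \<in> X\<close> mem_cl_colour_class[OF X] F by blast
  qed
  have eq: "c h = c e" if "h \<in> cl {f, e}" "h \<notin> cl {f}" "h \<notin> cl {e}" for h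
    using not_all_distinct[OF E(1,2) efn that] line[OF that(1,2)] f
      line[OF mem_cl_pair(2)[OF E(1,2)] efn] by auto
  show ?thesis
  proof (cases "g \<in> cl {e}")
    case False
    then show ?thesis using eq g by blast
  next
    case True
    \<comment> \<open>If \<open>g\<close> is parallel to \<open>e\<close>, then \<open>f\<close>,
      \<open>e\<close>, \<open>g\<close> is not a triangle; both are compared with a third point
      \<open>h\<close> instead.\<close>
    obtain h where h: "h \<in> cl {f, e}" "h \<notin> cl {f}" "h \<notin> cl {e}"
      using third_point[OF E(1,2) efn] .
    have hE: "h \<in> E" using h in_ground by blast
    have "cl {f, g} = cl {f, e}" using cl_pair_eq[OF g E(1,2)] .
    moreover have "cl {g} = cl {e}" using cl_singleton_eq[OF E(2) True] .
    ultimately have "c f = c g \<or> c f = c h \<or> c g = c h"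
      using not_all_distinct[OF E(1,3) g(2), of h] h by auto
    then show ?thesis using eq[OF h] line[OF h(1,2)] line[OF g] f by auto
  qed
qed

text \<open>The elements of \<open>F\<close> with this property form a line-closed set
  \<open>G\<close> that contains the colour class, hence all of \<open>F\<close>.\<close>

lemma line_to_span:
  assumes X: "flat X" and F: "F = cl (colour_class i X)"
    and f: "f \<in> F" and e: "e \<in> X" "e \<notin> F" and g: "g \<in> cl {f, e}" "g \<notin> cl {f}"
  shows "c g = c e"
proof -
  define G where "G = {f \<in> F. \<forall>e\<in>X - F. \<forall>g\<in>cl {f, e} - cl {f}. c g = c e}"
  have XE: "X \<subseteq> E" using flat_subset[OF X] .
  have flF: "flat F" and FX: "F \<subseteq> X"
    using flat_cl_colour_class cl_colour_class_subset X F by auto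
  have "flat G"
  proof (rule flat_if_line_closed)
    show "G \<subseteq> E" using FX XE by (auto simp: G_def)
  next
    fix x y z assume xyz: "x \<in> G" "y \<in> G" "z \<in> cl {x, y}"
    then have F3: "x \<in> F" "y \<in> F" "z \<in> F"
      using in_flat_pair[OF flF] by (auto simp: G_def)
    then have E3: "x \<in> E" "y \<in> E" "z \<in> E" using FX XE by auto
    have "c g = c e" if e: "e \<in> X" "e \<notin> F" and g: "g \<in> cl {z, e}" "g \<notin> cl {z}" for e g
    proof -
      have eE: "e \<in> E" using e XE by auto
      have gF: "g \<notin> F" using flat_pair_exchange[OF flF F3(3) _ g(2) g(1) eE] e by blast
      have "z \<in> cl {x, y, e}" using xyz(3) cl_mono[of "{x, y}" "{x, y, e}"] by blast
      then have "{z, e} \<subseteq> cl {x, y, e}" using subset_cl[of "{x, y, e}"] E3 eE by auto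
      then have "g \<in> cl {x, y, e}" using cl_trans[OF g(1)] E3 eE by simp
      \<comment> \<open>Go from \<open>e\<close> to \<open>g\<close> in two moves, along a line
        through \<open>y\<close> to \<open>a\<close> and then along a line through \<open>x\<close>;
        each move keeps the colour.\<close>
      then obtain a where a: "a \<in> cl {y, e}" "g \<in> cl {a, x}"
        using veblen[OF E3(2) eE E3(1)] by blast
      have aE: "a \<in> E" using a in_ground by blast
      have aX: "a \<in> X" using in_flat_pair[OF X _ e(1) a(1)] F3 FX by blast
      have aF: "a \<notin> F" using in_flat_pair[OF flF _ F3(1) a(2)] gF by blast
      have "a \<notin> cl {y}" using in_flat_singleton[OF flF F3(2)] aF by blast
      then have "c a = c e" using xyz(2) a e by (auto simp: G_def)
      moreover have "g \<notin> cl {x}" using in_flat_singleton[OF flF F3(1)] gF by blast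
      then have "c g = c a" using xyz(1) a aX aF by (auto simp: G_def insert_commute)
      ultimately show ?thesis by simp
    qed
    then show "z \<in> G" using F3 by (auto simp: G_def)
  qed
  moreover have "colour_class i X \<subseteq> G"
  proof
    fix x assume x: "x \<in> colour_class i X"
    then have "x \<in> X" "c x = i" by (auto simp: colour_class_def)
    then show "x \<in> G"
      using line_to_colour_class[OF X flF F] mem_cl_colour_class[OF X] F by (auto simp: G_def)
  qed
  ultimately have "F \<subseteq> G" using cl_subset_flat F by blast
  then show ?thesis using f e g by (auto simp: G_def)
qed

text \<open>The span of \<open>F\<close> and \<open>e\<close> is a union of lines joining
  \<open>e\<close> to elements of \<open>F\<close>, and each of these has the colour of
  \<open>e\<close> off \<open>F\<close>. The flat is nonempty because the colour occurs.\<close>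

lemma decomposer_cl_colour_class:
  assumes "i \<in> c ` E" "\<not> spans i E"
  shows "\<exists>F. F \<noteq> {} \<and> decomposer c F"
proof -
  let ?F = "cl (colour_class i E)"
  have E: "flat E" using cl_ground[of E] subset_cl[of E] by (auto simp: flat_def)
  have F: "flat ?F" using flat_cl_colour_class[OF E] .
  have ne: "?F \<noteq> {}" using mem_cl_colour_class[OF E] assms(1) by blast
  have mono: "c g = c e" if e: "e \<in> E - ?F" and g: "g \<in> cl (insert e ?F) - ?F" for e g
  proof -
    obtain f where f: "f \<in> ?F" "g \<in> cl {f, e}"
      using cl_insert_flat[OF F ne, of e g] e g by blast
    then have "g \<notin> cl {f}" using in_flat_singleton[OF F] g by blast
    then show ?thesis using line_to_span[OF E refl f(1)] e f by blast
  qed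
  have "decomposer c ?F"
    unfolding decomposer_def monochromatic_def
  proof (intro conjI ballI)
    show "flat ?F" by fact
    show "?F \<noteq> E" using assms by (simp add: spans_def)
    fix e x y assume "e \<in> E - ?F" "x \<in> cl (insert e ?F) - ?F" "y \<in> cl (insert e ?F) - ?F"
    then show "c x = c y" using mono[of e x] mono[of e y] by simp
  qed
  then show ?thesis using ne by blast
qed

end

section \<open>Tricoloured finite projective planes\<close>

text \<open>Points are abstract and partitioned into three classes, so that the counting is
  independent of matroids and can be repeated with the classes permuted. The impossibility takes the
  form \<open>L = {}\<close>.\<close>

locale tricoloured_plane =
  fixes L :: "'p set set" and A B C :: "'p set"
  assumes finite_points: "finite (A \<union> B \<union> C)"
    and disjoint: "A \<inter> B = {}" "A \<inter> C = {}" "B \<inter> C = {}"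
    and line_subset: "l \<in> L \<Longrightarrow> l \<subseteq> A \<union> B \<union> C"
    and line_exists: "x \<in> A \<union> B \<union> C \<Longrightarrow> y \<in> A \<union> B \<union> C \<Longrightarrow> x \<noteq> y \<Longrightarrow> \<exists>l\<in>L. x \<in> l \<and> y \<in> l"
    and lines_meet: "l \<in> L \<Longrightarrow> m \<in> L \<Longrightarrow> l \<inter> m \<noteq> {}"
    and line_unique: "l \<in> L \<Longrightarrow> m \<in> L \<Longrightarrow> x \<in> l \<inter> m \<Longrightarrow> y \<in> l \<inter> m \<Longrightarrow> x \<noteq> y \<Longrightarrow> l = m"
    and no_rainbow_line: "l \<in> L \<Longrightarrow> l \<inter> A = {} \<or> l \<inter> B = {} \<or> l \<inter> C = {}"
    and not_in_line: "l \<in> L \<Longrightarrow> \<not> A \<subseteq> l" "l \<in> L \<Longrightarrow> \<not> B \<subseteq> l" "l \<in> L \<Longrightarrow> \<not> C \<subseteq> l"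
begin

text \<open>Together with the rotation below, this generates all permutations of the classes, so
  each count is done for one order only.\<close>

lemma swap: "tricoloured_plane L B A C"
proof -
  have eq: "B \<union> A \<union> C = A \<union> B \<union> C" by auto
  show ?thesis
  proof (unfold_locales, unfold eq)
    fix l m x y
    show "finite (A \<union> B \<union> C)" "B \<inter> A = {}" "B \<inter> C = {}" "A \<inter> C = {}"
      using finite_points disjoint by auto
    show "l \<in> L \<Longrightarrow> l \<subseteq> A \<union> B \<union> C" by (rule line_subset)
    show "x \<in> A \<union> B \<union> C \<Longrightarrow> y \<in> A \<union> B \<union> C \<Longrightarrow> x \<noteq> y \<Longrightarrow> \<exists>l\<in>L. x \<in> l \<and> y \<in> l"
      by (rule line_exists)
    show "l \<in> L \<Longrightarrow> m \<in> L \<Longrightarrow> l \<inter> m \<noteq> {}" by (rule lines_meet)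
    show "l \<in> L \<Longrightarrow> m \<in> L \<Longrightarrow> x \<in> l \<inter> m \<Longrightarrow> y \<in> l \<inter> m \<Longrightarrow> x \<noteq> y \<Longrightarrow> l = m"
      by (rule line_unique)
    show "l \<in> L \<Longrightarrow> l \<inter> B = {} \<or> l \<inter> A = {} \<or> l \<inter> C = {}"
      using no_rainbow_line[of l] by blast
    show "l \<in> L \<Longrightarrow> \<not> B \<subseteq> l" "l \<in> L \<Longrightarrow> \<not> A \<subseteq> l" "l \<in> L \<Longrightarrow> \<not> C \<subseteq> l"
      by (fact not_in_line)+
  qed
qed

lemma rotate: "tricoloured_plane L B C A"
proof -
  have eq: "B \<union> C \<union> A = A \<union> B \<union> C" by auto
  show ?thesis
  proof (unfold_locales, unfold eq)
    fix l m x y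
    show "finite (A \<union> B \<union> C)" "B \<inter> C = {}" "B \<inter> A = {}" "C \<inter> A = {}"
      using finite_points disjoint by auto
    show "l \<in> L \<Longrightarrow> l \<subseteq> A \<union> B \<union> C" by (rule line_subset)
    show "x \<in> A \<union> B \<union> C \<Longrightarrow> y \<in> A \<union> B \<union> C \<Longrightarrow> x \<noteq> y \<Longrightarrow> \<exists>l\<in>L. x \<in> l \<and> y \<in> l"
      by (rule line_exists)
    show "l \<in> L \<Longrightarrow> m \<in> L \<Longrightarrow> l \<inter> m \<noteq> {}" by (rule lines_meet)
    show "l \<in> L \<Longrightarrow> m \<in> L \<Longrightarrow> x \<in> l \<inter> m \<Longrightarrow> y \<in> l \<inter> m \<Longrightarrow> x \<noteq> y \<Longrightarrow> l = m"
      by (rule line_unique)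
    show "l \<in> L \<Longrightarrow> l \<inter> B = {} \<or> l \<inter> C = {} \<or> l \<inter> A = {}"
      using no_rainbow_line[of l] by blast
    show "l \<in> L \<Longrightarrow> \<not> B \<subseteq> l" "l \<in> L \<Longrightarrow> \<not> C \<subseteq> l" "l \<in> L \<Longrightarrow> \<not> A \<subseteq> l"
      by (fact not_in_line)+
  qed
qed

section \<open>Counting points on lines and in colour classes\<close>

lemma finite_line: "l \<in> L \<Longrightarrow> finite l"
  using line_subset finite_points finite_subset by blast

lemma finite_L: "finite L"
  using line_subset finite_points by (intro finite_subset[of L "Pow (A \<union> B \<union> C)"]) auto

text \<open>Projecting from a point of \<open>C\<close> onto a line that meets \<open>A\<close> and \<open>B\<close>.\<close>

lemma card_pencil:
  assumes p: "p \<in> C" and l: "l \<in> L" "l \<inter> A \<noteq> {}" "l \<inter> B \<noteq> {}"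
  shows "card {m \<in> L. p \<in> m \<and> m \<inter> A \<noteq> {}} = card (l \<inter> A)"
proof -
  have lC: "l \<inter> C = {}" using no_rainbow_line l by blast
  then have pl: "p \<notin> l" using p by blast
  define f where "f m = (SOME x. x \<in> l \<inter> m)" for m
  have f: "f m \<in> l \<inter> m" if "m \<in> L" for m
    using lines_meet[OF l(1) that] unfolding f_def by (metis ex_in_conv someI_ex)
  have "bij_betw f {m \<in> L. p \<in> m \<and> m \<inter> A \<noteq> {}} (l \<inter> A)"
    unfolding bij_betw_def
  proof
    show "inj_on f {m \<in> L. p \<in> m \<and> m \<inter> A \<noteq> {}}"
    proof (rule inj_onI)
      fix m n assume mn: "m \<in> {m \<in> L. p \<in> m \<and> m \<inter> A \<noteq> {}}" "n \<in> {m \<in> L. p \<in> m \<and> m \<inter> A \<noteq> {}}"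
        and eq: "f m = f n"
      then have "f m \<in> m \<inter> n" "f m \<in> l" using f[of m] f[of n] by auto
      then show "m = n" using line_unique[of m n p "f m"] mn pl by blast
    qed
    show "f ` {m \<in> L. p \<in> m \<and> m \<inter> A \<noteq> {}} = l \<inter> A"
    proof
      show "f ` {m \<in> L. p \<in> m \<and> m \<inter> A \<noteq> {}} \<subseteq> l \<inter> A"
      proof
        fix x assume "x \<in> f ` {m \<in> L. p \<in> m \<and> m \<inter> A \<noteq> {}}"
        then obtain m where m: "m \<in> L" "p \<in> m" "m \<inter> A \<noteq> {}" "x \<in> l \<inter> m"
          using f by blast
        \<comment> \<open>A line through \<open>p\<close> that meets \<open>A\<close> cannot meet
          \<open>B\<close>, while \<open>l\<close> avoids \<open>C\<close>; hence it meets
          \<open>l\<close> in a point of \<open>A\<close>.\<close>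
        then have "m \<inter> B = {}" using no_rainbow_line[of m] p by blast
        then show "x \<in> l \<inter> A" using m lC line_subset[OF l(1)] by blast
      qed
      show "l \<inter> A \<subseteq> f ` {m \<in> L. p \<in> m \<and> m \<inter> A \<noteq> {}}"
      proof
        fix x assume x: "x \<in> l \<inter> A"
        then have "x \<noteq> p" using pl by blast
        then obtain m where m: "m \<in> L" "x \<in> m" "p \<in> m"
          using line_exists[of x p] x p by blast
        have "f m = x"
        proof (rule ccontr)
          assume "f m \<noteq> x"
          then have "l = m" using line_unique[of l m "f m" x] f m l x by blast
          then show False using m pl by blast
        qed
        then show "x \<in> f ` {m \<in> L. p \<in> m \<and> m \<inter> A \<noteq> {}}" using m x by blast
      qed
    qed
  qed
  then show ?thesis by (rule bij_betw_same_card)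
qed

lemma points_exist: "L \<noteq> {} \<Longrightarrow> C \<noteq> {}"
  using not_in_line(3) by blast

text \<open>Both numbers count the lines of one and the same pencil, centred at a point of
  \<open>C\<close>.\<close>

lemma card_line_const:
  assumes "l \<in> L" "l \<inter> A \<noteq> {}" "l \<inter> B \<noteq> {}" "m \<in> L" "m \<inter> A \<noteq> {}" "m \<inter> B \<noteq> {}"
  shows "card (m \<inter> A) = card (l \<inter> A)"
proof -
  obtain p where "p \<in> C" using points_exist assms by blast
  then show ?thesis using card_pencil[of p l] card_pencil[of p m] assms by simp
qed

text \<open>Since \<open>A\<close> is not contained in a line, a pencil centred in \<open>C\<close>
  has at least two lines meeting \<open>A\<close>, and projection turns these into points of
  \<open>l\<close>.\<close>

lemma two_le_card_line:
  assumes l: "l \<in> L" "l \<inter> A \<noteq> {}" "l \<inter> B \<noteq> {}"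
  shows "2 \<le> card (l \<inter> A)"
proof -
  obtain p where p: "p \<in> C" using points_exist assms by blast
  obtain a where a: "a \<in> A" using l by blast
  have "p \<noteq> a" using a p disjoint by blast
  then obtain m where m: "m \<in> L" "p \<in> m" "a \<in> m" using line_exists[of p a] a p by blast
  obtain b where b: "b \<in> A" "b \<notin> m" using not_in_line(1) m by blast
  have "p \<noteq> b" using b p disjoint by blast
  then obtain n where n: "n \<in> L" "p \<in> n" "b \<in> n" using line_exists[of p b] b p by blast
  have "{m, n} \<subseteq> {m \<in> L. p \<in> m \<and> m \<inter> A \<noteq> {}}" using m n a b by blast
  moreover have "card {m, n} = 2" using n b by (metis card_2_iff)
  moreover have "finite {m \<in> L. p \<in> m \<and> m \<inter> A \<noteq> {}}" using finite_L by simp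
  ultimately show ?thesis using card_pencil[OF p l] by (metis card_mono)
qed

text \<open>The lines through a point \<open>p\<close> of \<open>C\<close> partition
  \<open>A\<close>. By projection \<open>card (l \<inter> A)\<close> of them meet \<open>A\<close>,
  and each of those, having points in \<open>A\<close> and \<open>C\<close>, carries
  \<open>card (m \<inter> A)\<close> points of \<open>A\<close>.\<close>

lemma card_class_from_outside:
  assumes l: "l \<in> L" "l \<inter> A \<noteq> {}" "l \<inter> B \<noteq> {}"
    and m: "m \<in> L" "m \<inter> A \<noteq> {}" "m \<inter> C \<noteq> {}"
  shows "card A = card (l \<inter> A) * card (m \<inter> A)"
proof -
  interpret s: tricoloured_plane L C A B using tricoloured_plane.rotate[OF rotate] .
  interpret t: tricoloured_plane L A C B using s.swap .
  obtain p where p: "p \<in> C" using m by blast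
  let ?P = "{n \<in> L. p \<in> n \<and> n \<inter> A \<noteq> {}}"
  have "A = (\<Union>n\<in>?P. n \<inter> A)"
  proof
    show "A \<subseteq> (\<Union>n\<in>?P. n \<inter> A)"
    proof
      fix x assume x: "x \<in> A"
      then have "x \<noteq> p" using p disjoint by blast
      then obtain n where "n \<in> L" "x \<in> n" "p \<in> n" using line_exists[of x p] x p by blast
      then show "x \<in> (\<Union>n\<in>?P. n \<inter> A)" using x by blast
    qed
  qed auto
  moreover have "card (\<Union>n\<in>?P. n \<inter> A) = (\<Sum>n\<in>?P. card (n \<inter> A))"
  proof (rule card_UN_disjoint)
    show "finite ?P" using finite_L by simp
    show "\<forall>n\<in>?P. finite (n \<inter> A)" using finite_line by blast
    show "\<forall>n\<in>?P. \<forall>n'\<in>?P. n \<noteq> n' \<longrightarrow> (n \<inter> A) \<inter> (n' \<inter> A) = {}"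
    proof (intro ballI impI)
      fix n n' assume n: "n \<in> ?P" "n' \<in> ?P" "n \<noteq> n'"
      show "(n \<inter> A) \<inter> (n' \<inter> A) = {}"
      proof (rule ccontr)
        assume "(n \<inter> A) \<inter> (n' \<inter> A) \<noteq> {}"
        then obtain x where "x \<in> n \<inter> n'" "x \<in> A" by blast
        moreover have "x \<noteq> p" using \<open>x \<in> A\<close> p disjoint by blast
        ultimately show False using line_unique[of n n' x p] n by blast
      qed
    qed
  qed
  moreover have "(\<Sum>n\<in>?P. card (n \<inter> A)) = (\<Sum>n\<in>?P. card (m \<inter> A))"
  proof (rule sum.cong)
    fix n assume n: "n \<in> ?P"
    then have "n \<in> L" "n \<inter> A \<noteq> {}" "n \<inter> C \<noteq> {}" using p by auto
    then show "card (n \<inter> A) = card (m \<inter> A)" using t.card_line_const[OF m] by blast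
  qed simp
  ultimately show ?thesis using card_pencil[OF p l] by simp
qed

text \<open>Now the pencil is centred at \<open>p\<close> in \<open>A\<close>. Each of its lines
  meets \<open>k\<close>, which avoids \<open>A\<close>, so it has points in exactly one of
  \<open>B\<close> and \<open>C\<close>. The two kinds are counted by projection onto
  \<open>k\<close>, and \<open>p\<close> itself is counted separately.\<close>

lemma card_class_from_inside:
  assumes l: "l \<in> L" "l \<inter> A \<noteq> {}" "l \<inter> B \<noteq> {}"
    and m: "m \<in> L" "m \<inter> A \<noteq> {}" "m \<inter> C \<noteq> {}"
    and k: "k \<in> L" "k \<inter> B \<noteq> {}" "k \<inter> C \<noteq> {}"
  shows "card A = 1 + card (k \<inter> B) * (card (l \<inter> A) - 1) + card (k \<inter> C) * (card (m \<inter> A) - 1)"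
proof -
  interpret r: tricoloured_plane L B C A using rotate .
  interpret r': tricoloured_plane L C B A using r.swap .
  interpret s: tricoloured_plane L C A B using r.rotate .
  interpret t: tricoloured_plane L A C B using s.swap .
  obtain p where p: "p \<in> A" using l by blast
  let ?P = "{n \<in> L. p \<in> n \<and> n \<inter> B \<noteq> {}}" and ?Q = "{n \<in> L. p \<in> n \<and> n \<inter> C \<noteq> {}}"
  let ?f = "\<lambda>n. n \<inter> A - {p}"
  have finPQ: "finite (?P \<union> ?Q)" "finite ?P" "finite ?Q" using finite_L by auto
  have PQ: "?P \<inter> ?Q = {}" using no_rainbow_line p by blast
  have "A - {p} = (\<Union>n\<in>?P \<union> ?Q. ?f n)"
  proof
    show "A - {p} \<subseteq> (\<Union>n\<in>?P \<union> ?Q. ?f n)"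
    proof
      fix x assume x: "x \<in> A - {p}"
      then obtain n where n: "n \<in> L" "x \<in> n" "p \<in> n" using line_exists[of x p] p by blast
      have "k \<inter> A = {}" using no_rainbow_line k by blast
      then have "n \<inter> B \<noteq> {} \<or> n \<inter> C \<noteq> {}"
        using lines_meet[OF n(1) k(1)] line_subset[OF n(1)] by blast
      then show "x \<in> (\<Union>n\<in>?P \<union> ?Q. ?f n)" using n x by blast
    qed
  qed auto
  moreover have "card (\<Union>n\<in>?P \<union> ?Q. ?f n) = (\<Sum>n\<in>?P \<union> ?Q. card (?f n))"
  proof (rule card_UN_disjoint)
    show "finite (?P \<union> ?Q)" using finPQ by simp
    show "\<forall>n\<in>?P \<union> ?Q. finite (?f n)" using finite_line by blast
    show "\<forall>n\<in>?P \<union> ?Q. \<forall>n'\<in>?P \<union> ?Q. n \<noteq> n' \<longrightarrow> ?f n \<inter> ?f n' = {}"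
    proof (intro ballI impI)
      fix n n' assume n: "n \<in> ?P \<union> ?Q" "n' \<in> ?P \<union> ?Q" "n \<noteq> n'"
      show "?f n \<inter> ?f n' = {}"
      proof (rule ccontr)
        assume "?f n \<inter> ?f n' \<noteq> {}"
        then obtain x where "x \<in> n \<inter> n'" "x \<noteq> p" by blast
        then show False using line_unique[of n n' x p] n by blast
      qed
    qed
  qed
  moreover have "(\<Sum>n\<in>?P \<union> ?Q. card (?f n)) = (\<Sum>n\<in>?P. card (?f n)) + (\<Sum>n\<in>?Q. card (?f n))"
    using finPQ PQ by (intro sum.union_disjoint) auto
  moreover have f: "card (?f n) = card (n \<inter> A) - 1" if "p \<in> n" for n
    using that p by simp
  have "(\<Sum>n\<in>?P. card (?f n)) = (\<Sum>n\<in>?P. card (l \<inter> A) - 1)"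
  proof (rule sum.cong)
    fix n assume n: "n \<in> ?P"
    then have "n \<in> L" "n \<inter> A \<noteq> {}" "n \<inter> B \<noteq> {}" using p by auto
    then show "card (?f n) = card (l \<inter> A) - 1" using card_line_const[OF l] f n by simp
  qed simp
  moreover have "(\<Sum>n\<in>?Q. card (?f n)) = (\<Sum>n\<in>?Q. card (m \<inter> A) - 1)"
  proof (rule sum.cong)
    fix n assume n: "n \<in> ?Q"
    then have "n \<in> L" "n \<inter> A \<noteq> {}" "n \<inter> C \<noteq> {}" using p by auto
    then show "card (?f n) = card (m \<inter> A) - 1" using t.card_line_const[OF m] f n by simp
  qed simp
  moreover have "card ?P = card (k \<inter> B)" using r.card_pencil[OF p k] .
  moreover have "card ?Q = card (k \<inter> C)" using r'.card_pencil[OF p k(1,3,2)] .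
  moreover have "card A = 1 + card (A - {p})"
    using card.remove[OF _ p] finite_points by simp
  ultimately show ?thesis by simp
qed

text \<open>The product equals \<open>(u - 1) (v - 1)\<close> for the numbers \<open>u, v\<close> of \<open>B\<close>- and \<open>C\<close>-points on \<open>k\<close>.\<close>

lemma card_product_positive:
  assumes l: "l \<in> L" "l \<inter> A \<noteq> {}" "l \<inter> B \<noteq> {}"
    and m: "m \<in> L" "m \<inter> A \<noteq> {}" "m \<inter> C \<noteq> {}"
    and k: "k \<in> L" "k \<inter> B \<noteq> {}" "k \<inter> C \<noteq> {}"
  shows "0 < (int (card (l \<inter> A)) - int (card (k \<inter> C))) * (int (card (m \<inter> A)) - int (card (k \<inter> B)))"
proof -
  interpret r: tricoloured_plane L B C A using rotate .
  interpret r': tricoloured_plane L C B A using r.swap .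
  interpret s: tricoloured_plane L C A B using r.rotate .
  interpret t: tricoloured_plane L A C B using s.swap .
  have ge: "2 \<le> card (l \<inter> A)" "2 \<le> card (m \<inter> A)" "2 \<le> card (k \<inter> B)" "2 \<le> card (k \<inter> C)"
    using two_le_card_line[OF l] t.two_le_card_line[OF m] r.two_le_card_line[OF k]
      r'.two_le_card_line[OF k(1,3,2)] by auto
  let ?x = "int (card (l \<inter> A))" and ?y = "int (card (m \<inter> A))"
    and ?u = "int (card (k \<inter> B))" and ?v = "int (card (k \<inter> C))"
  have "int (card (l \<inter> A) * card (m \<inter> A)) =
      int (1 + card (k \<inter> B) * (card (l \<inter> A) - 1) + card (k \<inter> C) * (card (m \<inter> A) - 1))"
    using card_class_from_outside[OF l m] card_class_from_inside[OF l m k] by simp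
  \<comment> \<open>The counts on \<open>l\<close> and \<open>m\<close> are at least 2, so the
    truncated \<open>- 1\<close> is genuine subtraction over the integers.\<close>
  then have "?x * ?y = 1 + ?u * (?x - 1) + ?v * (?y - 1)"
    using ge by (simp add: of_nat_diff)
  then have "(?x - ?v) * (?y - ?u) = (?u - 1) * (?v - 1)"
    by (simp add: algebra_simps)
  then show ?thesis using ge by simp
qed

theorem no_lines: "L = {}"
proof (rule ccontr)
  assume L: "L \<noteq> {}"
  interpret r: tricoloured_plane L B C A using rotate .
  interpret s: tricoloured_plane L C A B using r.rotate .
  obtain a b d where abc: "a \<in> A" "b \<in> B" "d \<in> C"
    using L points_exist r.points_exist s.points_exist by blast
  then have ne: "a \<noteq> b" "a \<noteq> d" "b \<noteq> d" using disjoint by auto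
  obtain l where l: "l \<in> L" "l \<inter> A \<noteq> {}" "l \<inter> B \<noteq> {}" using line_exists[of a b] abc ne by blast
  obtain m where m: "m \<in> L" "m \<inter> A \<noteq> {}" "m \<inter> C \<noteq> {}" using line_exists[of a d] abc ne by blast
  obtain k where k: "k \<in> L" "k \<inter> B \<noteq> {}" "k \<inter> C \<noteq> {}" using line_exists[of b d] abc ne by blast
  \<comment> \<open>For suitable differences P, Q, R the three facts read PQ > 0, QR < 0 and RP > 0,
    but the product of the three left sides is a square.\<close>
  show False
    using card_product_positive[OF l m k] r.card_product_positive[OF k l(1,3,2) m(1,3,2)]
      s.card_product_positive[OF m(1,3,2) k(1,3,2) l]
    by (auto simp: zero_less_mult_iff)
qed

end

section \<open>Lines and planes\<close>

context connected_modular_matroid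
begin

lemma mem_cl_singleton_iff:
  assumes "a \<in> E" "b \<in> E"
  shows "b \<in> cl {a} \<longleftrightarrow> cl {a} = cl {b}"
  using assms cl_singleton_eq[of a b] mem_cl_singleton[of b] by blast

lemma line_eq:
  assumes E: "x \<in> E" "y \<in> E" and pq: "p \<in> cl {x, y}" "q \<in> cl {x, y}" "cl {p} \<noteq> cl {q}"
  shows "cl {p, q} = cl {x, y}"
proof -
  have pE: "p \<in> E" and qE: "q \<in> E" using pq in_ground by auto
  show ?thesis
  proof (cases "p \<in> cl {x}")
    case False
    then have 1: "cl {x, p} = cl {x, y}" using cl_pair_eq pq E by blast
    have "q \<notin> cl {p}" using mem_cl_singleton_iff pE qE pq by blast
    then have "cl {p, q} = cl {p, x}"
      using cl_pair_eq[of q p x] 1 pq pE E by (simp add: insert_commute)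
    then show ?thesis using 1 by (simp add: insert_commute)
  next
    case True
    then have px: "cl {x} = cl {p}" using mem_cl_singleton_iff E pE by blast
    have "q \<notin> cl {x}" using mem_cl_singleton_iff[of x q] px pq E qE by simp
    then have 1: "cl {x, q} = cl {x, y}" using cl_pair_eq pq E by blast
    have "p \<notin> cl {q}" using mem_cl_singleton_iff[of q p] pq pE qE by auto
    then have "cl {q, p} = cl {q, x}"
      using cl_pair_eq[of p q x] 1 pq qE E by (simp add: insert_commute)
    then show ?thesis using 1 by (simp add: insert_commute)
  qed
qed

lemma cl_eq_if_rank_eq:
  assumes "A \<subseteq> B" "B \<subseteq> E" "rank A = rank B"
  shows "cl A = cl B"
proof -
  have "B \<subseteq> cl A"
  proof
    fix e assume e: "e \<in> B"
    show "e \<in> cl A"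
    proof (rule ccontr)
      assume "e \<notin> cl A"
      then have "rank (insert e A) = Suc (rank A)" using rank_insert e assms by blast
      moreover have "rank (insert e A) \<le> rank B" using rank_mono[of "insert e A" B] e assms by blast
      ultimately show False using assms by simp
    qed
  qed
  then have "cl B \<subseteq> cl A" using cl_subset_iff[of B A] assms by auto
  then show ?thesis using cl_mono[OF assms(1)] by blast
qed

lemma rank_line:
  assumes "a \<in> E" "b \<in> E" "cl {a} \<noteq> cl {b}"
  shows "rank (cl {a, b}) = 2"
  using rank_pair[of a b] rank_cl[of "{a, b}"] mem_cl_singleton_iff assms by auto

lemma line_neq_plane:
  assumes "a \<in> X" "b \<in> X" "cl {a} \<noteq> cl {b}" "flat X" "rank X = 3"
  shows "cl {a, b} \<noteq> X"
proof -
  have "rank (cl {a, b}) = 2" using rank_line[of a b] assms flat_subset[of X] by blast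
  then show ?thesis using assms(5) by auto
qed

text \<open>If \<open>p\<close> is off the line through \<open>a\<close> and \<open>b\<close>, then
  the two span the plane, so \<open>q\<close> lies on a line joining \<open>p\<close> to some
  \<open>t\<close> of that line; exchange puts \<open>t\<close> on the line through \<open>p\<close>
  and \<open>q\<close>.\<close>

lemma plane_lines_meet:
  assumes X: "flat X" "rank X = 3" and ab: "a \<in> X" "b \<in> X" "cl {a} \<noteq> cl {b}"
    and pq: "p \<in> X" "q \<in> X" "cl {p} \<noteq> cl {q}"
  obtains t where "t \<in> cl {a, b}" "t \<in> cl {p, q}"
proof (cases "p \<in> cl {a, b}")
  case True
  then show ?thesis using that[of p] mem_cl_pair[of p q] pq X flat_subset by blast
next
  case False
  have E: "a \<in> E" "b \<in> E" "p \<in> E" "q \<in> E" using ab pq X flat_subset by auto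
  have abE: "{a, b} \<subseteq> E" using E by auto
  have "rank (insert p (cl {a, b})) = rank X"
    using rank_insert[of p "cl {a, b}"] False E cl_idem[OF abE] rank_line[OF E(1,2) ab(3)] X by simp
  moreover have "insert p (cl {a, b}) \<subseteq> X" using cl_subset_flat[of X "{a, b}"] ab pq X by auto
  ultimately have "cl (insert p (cl {a, b})) = X"
    using cl_eq_if_rank_eq[of _ X] X flat_subset[of X] flat_cl_eq[of X] by simp
  moreover have "cl {a, b} \<noteq> {}" using mem_cl_pair E by blast
  ultimately obtain t where t: "t \<in> cl {a, b}" "q \<in> cl {t, p}"
    using cl_insert_flat[OF flat_cl[OF abE], of p q] pq E by blast
  have "q \<notin> cl {p}" using mem_cl_singleton_iff E pq by blast
  then have "t \<in> cl {p, q}"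
    using cl_pair_exchange[of q p t] t in_ground[OF t(1)] by (simp add: insert_commute)
  then show ?thesis using that t by blast
qed

end

section \<open>Three spanning colours on a line or in a plane\<close>

context rainbow_free_matroid
begin

lemma line_not_all_distinct:
  assumes "x \<in> E" "y \<in> E" "p \<in> cl {x, y}" "q \<in> cl {x, y}" "r \<in> cl {x, y}"
    "cl {p} \<noteq> cl {q}" "cl {p} \<noteq> cl {r}" "cl {q} \<noteq> cl {r}"
  shows "c p = c q \<or> c p = c r \<or> c q = c r"
proof -
  have E: "p \<in> E" "q \<in> E" "r \<in> E" using assms in_ground by auto
  have "r \<in> cl {p, q}" using line_eq[of x y p q] assms by simp
  then show ?thesis using not_all_distinct[of p q r] mem_cl_singleton_iff E assms by auto
qed

text \<open>Parallel elements may differ in colour, so points can be bicoloured. Choosing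
  \<open>p\<close> of colour \<open>i\<close> and \<open>q\<close> of colour \<open>j\<close> at
  different points forces colour \<open>k\<close> to occur at both points as well, and then no
  colour is left for a third point.\<close>

lemma not_all_span_line:
  assumes E: "x \<in> E" "y \<in> E" and ijk: "i \<noteq> j" "i \<noteq> k" "j \<noteq> k" "c ` cl {x, y} \<subseteq> {i, j, k}"
    and ne: "cl {x} \<noteq> cl {y}"
    and sp: "spans i (cl {x, y})" "spans j (cl {x, y})" "spans k (cl {x, y})"
  shows False
proof -
  let ?X = "cl {x, y}"
  have xy: "{x, y} \<subseteq> E" using E by auto
  have X: "flat ?X" using flat_cl[OF xy] .
  have off: "\<exists>q\<in>?X. c q = m \<and> cl {p} \<noteq> cl {q}" if m: "spans m ?X" and p: "p \<in> ?X" for p m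
  proof -
    have pE: "p \<in> E" using p in_ground by blast
    have "cl {p} \<subseteq> ?X" using cl_subset_flat[OF X, of "{p}"] p by blast
    moreover have "rank (cl {p}) = 1" using rank_singleton rank_cl pE by simp
    then have "cl {p} \<noteq> ?X" using rank_line[OF E ne] by auto
    moreover have "flat (cl {p})" using flat_cl pE by simp
    ultimately obtain q where "q \<in> ?X" "c q = m" "q \<notin> cl {p}"
      using spans_not_subset[OF m, of "cl {p}"] by blast
    then show ?thesis using mem_cl_singleton_iff[OF pE, of q] in_ground[of q] by blast
  qed
  obtain p where p: "p \<in> ?X" "c p = i" using off[OF sp(1)] mem_cl_pair(1)[OF E] by blast
  obtain q where q: "q \<in> ?X" "c q = j" "cl {p} \<noteq> cl {q}" using off[OF sp(2) p(1)] by blast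
  obtain r where r: "r \<in> ?X" "c r = k" "cl {p} \<noteq> cl {r}" using off[OF sp(3) p(1)] by blast
  obtain s where s: "s \<in> ?X" "c s = k" "cl {q} \<noteq> cl {s}" using off[OF sp(3) q(1)] by blast
  have pqE: "p \<in> E" "q \<in> E" using p q in_ground by auto
  obtain t where t: "t \<in> cl {p, q}" "t \<notin> cl {p}" "t \<notin> cl {q}"
    using third_point[of p q] mem_cl_singleton_iff[OF pqE] pqE q by blast
  then have tX: "t \<in> ?X" using line_eq[OF E p(1) q(1) q(3)] by simp
  have tne: "cl {p} \<noteq> cl {t}" "cl {q} \<noteq> cl {t}"
    using mem_cl_singleton_iff[of _ t] pqE t in_ground[OF t(1)] by auto
  have qr: "cl {q} = cl {r}" using line_not_all_distinct[OF E p(1) q(1) r(1)] p q r ijk by auto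
  have ps: "cl {p} = cl {s}" using line_not_all_distinct[OF E p(1) q(1) s(1)] p q s ijk by auto
  \<comment> \<open>Against both points in each available colouring, \<open>t\<close> must have a
    colour in each of \<open>{j, k}\<close>, \<open>{i, k}\<close> and \<open>{i, j}\<close>, which
    have no common element.\<close>
  have "c t = j \<or> c t = k"
    using line_not_all_distinct[OF E tX q(1) s(1)] tne ps q s ijk(3) by metis
  moreover have "c t = i \<or> c t = k"
    using line_not_all_distinct[OF E p(1) tX r(1)] tne qr p r ijk(2) by metis
  moreover have "c t = i \<or> c t = j"
    using line_not_all_distinct[OF E p(1) q(1) tX] tne p q ijk(1) by metis
  ultimately show False using ijk by auto
qed

text \<open>Given an element of colour \<open>k\<close> at another point of the line, comparison
  with \<open>p\<close> leaves \<open>i\<close> or \<open>k\<close>, and comparison with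
  \<open>p'\<close> leaves \<open>j\<close> or \<open>k\<close>.\<close>

lemma line_through_bicoloured_point:
  assumes E: "p \<in> E" "p' \<in> E" "z \<in> E"
    and p: "cl {p} = cl {p'}" "c p = i" "c p' = j" and z: "c z = k" "cl {p} \<noteq> cl {z}"
    and ijk: "i \<noteq> j" "i \<noteq> k" "j \<noteq> k" "c ` cl {p, z} \<subseteq> {i, j, k}"
    and u: "u \<in> cl {p, z}" "cl {p} \<noteq> cl {u}"
  shows "c u = k"
proof -
  have pl: "p \<in> cl {p, z}" "z \<in> cl {p, z}" using mem_cl_pair E by auto
  have "p' \<in> cl {p}" using mem_cl_singleton_iff E p by simp
  then have p'l: "p' \<in> cl {p, z}" using cl_mono[of "{p}" "{p, z}"] by blast
  have *: "c v = k" if "v \<in> cl {p, z}" "cl {p} \<noteq> cl {v}" "cl {z} \<noteq> cl {v}" for v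
  proof -
    have "c v = i \<or> c v = k"
      using line_not_all_distinct[OF E(1,3) pl that(1)] that p(2) z ijk(2) by metis
    moreover have "c v = j \<or> c v = k"
      using line_not_all_distinct[OF E(1,3) p'l pl(2) that(1)] that p z ijk(3) by metis
    ultimately show ?thesis using ijk(1) by metis
  qed
  show ?thesis
  proof (cases "cl {z} = cl {u}")
    case False
    then show ?thesis using * u by blast
  next
    case True
    \<comment> \<open>If \<open>u\<close> is parallel to \<open>z\<close>, a third point, already
      known to have colour \<open>k\<close>, takes the place of \<open>z\<close>.\<close>
    obtain t where t: "t \<in> cl {p, z}" "t \<notin> cl {p}" "t \<notin> cl {z}"
      using third_point[of p z] mem_cl_singleton_iff[OF E(1,3)] E z by blast
    have tne: "cl {p} \<noteq> cl {t}" "cl {z} \<noteq> cl {t}"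
      using mem_cl_singleton_iff[of _ t] E t in_ground[OF t(1)] by auto
    have "c t = k" using * t tne by blast
    then have "c u = i \<or> c u = k"
      using line_not_all_distinct[OF E(1,3) pl(1) u(1) t(1)] tne u(2) p(2) True ijk(2) by metis
    moreover have "c u = j \<or> c u = k"
      using \<open>c t = k\<close> line_not_all_distinct[OF E(1,3) p'l u(1) t(1)] tne u(2) p True ijk(3) by metis
    ultimately show ?thesis using ijk(1) by metis
  qed
qed

text \<open>Bicoloured points cannot occur in such a plane. The line from \<open>p\<close> to
  \<open>z\<close> has colour \<open>k\<close> away from \<open>p\<close>; a line through an
  \<open>i\<close>-element \<open>x\<close> and a \<open>j\<close>-element \<open>y\<close> chosen
  off \<open>p\<close> meets it in some \<open>w\<close> of colour \<open>k\<close>, and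
  \<open>x\<close>, \<open>y\<close>, \<open>w\<close> are rainbow.\<close>

lemma parallel_monochromatic_plane:
  assumes X: "flat X" "rank X = 3" and ijk: "i \<noteq> j" "i \<noteq> k" "j \<noteq> k" "c ` X \<subseteq> {i, j, k}"
    and sp: "spans i X" "spans j X" "spans k X"
    and p: "p \<in> X" "p' \<in> X" "cl {p} = cl {p'}" "c p = i" "c p' = j"
  shows False
proof -
  have XE: "X \<subseteq> E" using flat_subset X by blast
  have line: "flat (cl {p, q}) \<and> cl {p, q} \<subseteq> X" if "q \<in> X" for q
    using flat_cl[of "{p, q}"] cl_subset_flat[OF X(1), of "{p, q}"] p that XE by auto
  have pE: "p \<in> E" "p' \<in> E" using p XE by auto
  have "flat (cl {p})" "cl {p} \<subseteq> X"
    using flat_cl[of "{p}"] cl_subset_flat[OF X(1), of "{p}"] p XE by auto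
  moreover have "rank (cl {p}) = 1" using rank_singleton rank_cl pE by simp
  then have "cl {p} \<noteq> X" using X by auto
  ultimately obtain z where z: "z \<in> X" "c z = k" "z \<notin> cl {p}" using spans_not_subset[OF sp(3), of "cl {p}"] by blast
  have zE: "z \<in> E" using z XE by blast
  have pz: "cl {p} \<noteq> cl {z}" using mem_cl_singleton_iff pE zE z by blast
  obtain y where y: "y \<in> X" "c y = j" "y \<notin> cl {p, z}"
    using spans_not_subset[OF sp(2), of "cl {p, z}"] line[OF z(1)] line_neq_plane[OF p(1) z(1) pz X] by blast
  have yE: "y \<in> E" using y XE by blast
  have py: "cl {p} \<noteq> cl {y}"
    using mem_cl_singleton_iff[OF pE(1) yE] y cl_mono[of "{p}" "{p, z}"] by blast
  obtain x where x: "x \<in> X" "c x = i" "x \<notin> cl {p, y}"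
    using spans_not_subset[OF sp(1), of "cl {p, y}"] line[OF y(1)] line_neq_plane[OF p(1) y(1) py X] by blast
  have xE: "x \<in> E" using x XE by blast
  have px: "cl {p} \<noteq> cl {x}"
    using mem_cl_singleton_iff[OF pE(1) xE] x cl_mono[of "{p}" "{p, y}"] by blast
  have yx: "cl {y} \<noteq> cl {x}"
    using mem_cl_singleton_iff[OF yE xE] x cl_mono[of "{y}" "{p, y}"] by blast
  have col: "c ` cl {p, z} \<subseteq> {i, j, k}" using ijk line[OF z(1)] by blast
  have xl: "x \<notin> cl {p, z}"
    using line_through_bicoloured_point[OF pE zE p(3-5) z(2) pz ijk(1-3) col _ px] x ijk by auto
  obtain w where w: "w \<in> cl {p, z}" "w \<in> cl {x, y}"
    using plane_lines_meet[OF X p(1) z(1) pz x(1) y(1)] yx by metis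
  have wE: "w \<in> E" using w in_ground by blast
  \<comment> \<open>This is why \<open>x\<close> was chosen off the line through \<open>p\<close>
    and \<open>y\<close>: if \<open>w\<close> were parallel to \<open>p\<close>, that line would
    contain \<open>x\<close>.\<close>
  have wp: "cl {p} \<noteq> cl {w}"
  proof
    assume eq: "cl {p} = cl {w}"
    have "p \<in> cl {x, y}"
      using mem_cl_singleton_iff[OF wE pE(1)] eq cl_trans[of p "{w}" "{x, y}"] w xE yE by auto
    then have "p \<in> cl {y, x}" by (simp add: insert_commute)
    moreover have "p \<notin> cl {y}" using mem_cl_singleton_iff[OF yE pE(1)] py by auto
    ultimately have "x \<in> cl {y, p}" using cl_pair_exchange xE by blast
    then show False using x by (simp add: insert_commute)
  qed
  have "c w = k" using line_through_bicoloured_point[OF pE zE p(3-5) z(2) pz ijk(1-3) col w(1) wp] .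
  moreover have "cl {v} \<noteq> cl {w}" if "v \<notin> cl {p, z}" "v \<in> E" for v
    using that mem_cl_singleton_iff[OF wE that(2)] cl_trans[of v "{w}" "{p, z}"] w pE zE by auto
  then have "cl {x} \<noteq> cl {w}" "cl {y} \<noteq> cl {w}" using xl y xE yE by auto
  ultimately show False
    using line_not_all_distinct[OF xE yE _ _ w(2)] mem_cl_pair[OF xE yE] yx x y ijk by metis
qed

text \<open>Pass to rank-one flats by \<open>pt\<close>. Colour is constant on each of them by the
  previous lemma, so the images of the colour classes are disjoint and form a
  \<open>tricoloured_plane\<close>, which has no lines although \<open>X\<close> does.\<close>

lemma not_all_span_plane:
  assumes X: "flat X" "rank X = 3" and ijk: "i \<noteq> j" "i \<noteq> k" "j \<noteq> k" "c ` X \<subseteq> {i, j, k}"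
    and sp: "spans i X" "spans j X" "spans k X"
  shows False
proof -
  define pt where "pt x = cl {x}" for x
  define L where "L = {pt ` cl {a, b} | a b. a \<in> X \<and> b \<in> X \<and> pt a \<noteq> pt b}"
  have XE: "X \<subseteq> E" using flat_subset X by blast
  have mono: "c x = c y" if xy: "x \<in> X" "y \<in> X" "pt x = pt y" for x y
  proof (rule ccontr)
    assume ne: "c x \<noteq> c y"
    have eq: "cl {x} = cl {y}" using xy by (simp add: pt_def)
    have "c x \<in> {i, j, k}" "c y \<in> {i, j, k}" using ijk xy by auto
    then consider "c x = i" "c y = j" | "c x = j" "c y = i" | "c x = i" "c y = k" | "c x = k" "c y = i"
      | "c x = j" "c y = k" | "c x = k" "c y = j" using ne by auto
    then show False
    proof cases
      case 1 then show ?thesis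
        using parallel_monochromatic_plane[OF X, of i j k] ijk sp xy eq by blast
    next
      case 2 then show ?thesis
        using parallel_monochromatic_plane[OF X, of i j k y x] ijk sp xy eq by simp
    next
      case 3 then show ?thesis
        using parallel_monochromatic_plane[OF X, of i k j x y] ijk sp xy eq by (simp add: insert_commute)
    next
      case 4 then show ?thesis
        using parallel_monochromatic_plane[OF X, of i k j y x] ijk sp xy eq by (simp add: insert_commute)
    next
      case 5 then show ?thesis
        using parallel_monochromatic_plane[OF X, of j k i x y] ijk sp xy eq by (simp add: insert_commute)
    next
      case 6 then show ?thesis
        using parallel_monochromatic_plane[OF X, of j k i y x] ijk sp xy eq by (simp add: insert_commute)
    qed
  qed
  let ?C = "\<lambda>m. pt ` colour_class m X"
  have disj: "?C m \<inter> ?C n = {}" if "m \<noteq> n" for m n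
  proof (rule ccontr)
    assume "?C m \<inter> ?C n \<noteq> {}"
    then obtain x y where "x \<in> X" "c x = m" "y \<in> X" "c y = n" "pt x = pt y"
      by (auto simp: colour_class_def)
    then show False using mono[of x y] that by simp
  qed
  have U: "?C i \<union> ?C j \<union> ?C k = pt ` X"
    using ijk(4) by (auto simp: colour_class_def)
  have in_pt: "x \<in> cl {a, b}" if "pt x \<in> pt ` cl {a, b}" "x \<in> E" "a \<in> E" "b \<in> E" for x a b
  proof -
    obtain y where y: "y \<in> cl {a, b}" "cl {x} = cl {y}" using \<open>pt x \<in> _\<close> by (auto simp: pt_def)
    then have "x \<in> cl {y}" using mem_cl_singleton \<open>x \<in> E\<close> by blast
    then show ?thesis using cl_trans[of x "{y}" "{a, b}"] y that by auto
  qed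
  have line_sub: "cl {a, b} \<subseteq> X" if "a \<in> X" "b \<in> X" for a b
    using cl_subset_flat[OF X(1), of "{a, b}"] that by auto
  have notin: "\<not> ?C m \<subseteq> l" if m: "spans m X" and l: "l \<in> L" for m l
  proof
    assume sub: "?C m \<subseteq> l"
    obtain a b where ab: "l = pt ` cl {a, b}" "a \<in> X" "b \<in> X" "pt a \<noteq> pt b"
      using l by (auto simp: L_def)
    have abE: "a \<in> E" "b \<in> E" using ab XE by auto
    have fl: "flat (cl {a, b})" using flat_cl[of "{a, b}"] abE by simp
    obtain x where x: "x \<in> X" "c x = m" "x \<notin> cl {a, b}"
      using spans_not_subset[OF m fl line_sub[OF ab(2,3)]] line_neq_plane[OF ab(2,3) _ X] ab(4)
      by (auto simp: pt_def)
    then have "pt x \<in> l" using sub by (auto simp: colour_class_def)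
    then show False using in_pt[of x a b] x ab abE XE by auto
  qed
  have "tricoloured_plane L (?C i) (?C j) (?C k)"
  proof (unfold_locales, unfold U)
    fix l m x y
    show "finite (pt ` X)" using finite_subset[OF XE finite_ground] by simp
    show "?C i \<inter> ?C j = {}" "?C i \<inter> ?C k = {}" "?C j \<inter> ?C k = {}" using disj ijk by auto
    show "l \<subseteq> pt ` X" if "l \<in> L" using that line_sub by (auto simp: L_def)
    show "\<exists>l\<in>L. x \<in> l \<and> y \<in> l" if xy: "x \<in> pt ` X" "y \<in> pt ` X" "x \<noteq> y"
    proof -
      obtain a b where ab: "a \<in> X" "b \<in> X" "x = pt a" "y = pt b" using xy by blast
      then have "pt ` cl {a, b} \<in> L" using xy by (auto simp: L_def)
      moreover have "a \<in> cl {a, b}" "b \<in> cl {a, b}" using mem_cl_pair[of a b] ab XE by auto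
      ultimately show ?thesis using ab by blast
    qed
    show "l \<inter> m \<noteq> {}" if lm: "l \<in> L" "m \<in> L"
    proof -
      obtain a b where ab: "l = pt ` cl {a, b}" "a \<in> X" "b \<in> X" "cl {a} \<noteq> cl {b}"
        using lm by (auto simp: L_def pt_def)
      obtain p q where pq: "m = pt ` cl {p, q}" "p \<in> X" "q \<in> X" "cl {p} \<noteq> cl {q}"
        using lm by (auto simp: L_def pt_def)
      show ?thesis using plane_lines_meet[OF X ab(2-4) pq(2-4)] ab(1) pq(1) by blast
    qed
    show "l = m" if lm: "l \<in> L" "m \<in> L" and xy: "x \<in> l \<inter> m" "y \<in> l \<inter> m" "x \<noteq> y"
    proof -
      obtain a b where ab: "l = pt ` cl {a, b}" "a \<in> X" "b \<in> X" using lm by (auto simp: L_def)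
      obtain p q where pq: "m = pt ` cl {p, q}" "p \<in> X" "q \<in> X" using lm by (auto simp: L_def)
      have E: "a \<in> E" "b \<in> E" "p \<in> E" "q \<in> E" using ab pq XE by auto
      obtain u where u: "u \<in> cl {a, b}" "x = pt u" using xy ab by blast
      obtain v where v: "v \<in> cl {a, b}" "y = pt v" using xy ab by blast
      have uv: "u \<in> cl {p, q}" "v \<in> cl {p, q}"
        using in_pt[of u p q] in_pt[of v p q] u v xy pq E in_ground by auto
      have "cl {u} \<noteq> cl {v}" using xy u v by (simp add: pt_def)
      then have "cl {a, b} = cl {p, q}"
        using line_eq[OF E(1,2) u(1) v(1)] line_eq[OF E(3,4) uv] by simp
      then show ?thesis using ab pq by simp
    qed
    show "l \<inter> ?C i = {} \<or> l \<inter> ?C j = {} \<or> l \<inter> ?C k = {}" if l: "l \<in> L"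
    proof (rule ccontr)
      assume "\<not> ?thesis"
      then obtain u v w where uvw: "u \<in> X" "v \<in> X" "w \<in> X" "c u = i" "c v = j" "c w = k"
        "pt u \<in> l" "pt v \<in> l" "pt w \<in> l" by (auto simp: colour_class_def)
      obtain a b where ab: "l = pt ` cl {a, b}" "a \<in> X" "b \<in> X" using l by (auto simp: L_def)
      have E: "a \<in> E" "b \<in> E" using ab XE by auto
      have "u \<in> cl {a, b}" "v \<in> cl {a, b}" "w \<in> cl {a, b}"
        using in_pt[OF _ _ E] uvw(1-3,7-9)[unfolded ab(1)] XE by blast+
      moreover have "cl {u} \<noteq> cl {v}" "cl {u} \<noteq> cl {w}" "cl {v} \<noteq> cl {w}"
        using mono[of u v] mono[of u w] mono[of v w] uvw(1-6) ijk(1-3) unfolding pt_def by metis+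
      ultimately show False
        using line_not_all_distinct[OF E, of u v w] uvw(4-6) ijk(1-3) by simp
    qed
    show "\<not> ?C i \<subseteq> l" "\<not> ?C j \<subseteq> l" "\<not> ?C k \<subseteq> l" if "l \<in> L"
      using notin[OF _ that] sp by blast+
  qed
  then have L: "L = {}" by (rule tricoloured_plane.no_lines)
  have "\<exists>a\<in>X. \<exists>b\<in>X. pt a \<noteq> pt b"
  proof -
    have "flat {}" "{} \<noteq> X" using flat_empty X rank_empty by auto
    then obtain a where a: "a \<in> X" "c a = i" using spans_not_subset[OF sp(1), of "{}"] by blast
    obtain b where b: "b \<in> X" "c b = j"
      using spans_not_subset[OF sp(2), of "{}"] \<open>flat {}\<close> \<open>{} \<noteq> X\<close> by blast
    show ?thesis using mono[OF a(1) b(1)] a b ijk(1) by metis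
  qed
  then obtain a b where "a \<in> X" "b \<in> X" "pt a \<noteq> pt b" by blast
  then have "pt ` cl {a, b} \<in> L" unfolding L_def by blast
  then show False using L by simp
qed

end

section \<open>Passing from a hyperplane to its span\<close>

text \<open>The configuration to be refuted in the induction step. The assumption
  \<open>hyperplane\<close> expresses that \<open>H\<close> has corank at most one in
  \<open>X\<close> by spans instead of ranks. Colour \<open>i\<close> is the one failing to span
  \<open>H\<close>; \<open>j\<close> and \<open>k\<close> remain interchangeable.\<close>

locale spanned_extension = rainbow_free_matroid E indep c
  for E :: "'a set" and indep and c :: "'a \<Rightarrow> 'c" +
  fixes X H :: "'a set" and i j k :: 'c
  assumes flat_X: "flat X" and flat_H: "flat H" and HX: "H \<subseteq> X" and H_nonempty: "H \<noteq> {}"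
    and hyperplane: "e \<in> X - H \<Longrightarrow> X \<subseteq> cl (insert e H)"
    and colours: "i \<noteq> j" "i \<noteq> k" "j \<noteq> k" "c ` X \<subseteq> {i, j, k}"
    and all_span: "spans i X" "spans j X" "spans k X"
    and not_span_H: "\<not> spans i H"
begin

definition F :: "'a set" where
  "F = cl (colour_class i H)"

lemma swap: "spanned_extension E indep c X H i k j"
  using flat_X flat_H HX H_nonempty hyperplane colours all_span not_span_H
  by unfold_locales auto

lemma X_ground: "x \<in> X \<Longrightarrow> x \<in> E"
  using flat_subset[OF flat_X] by blast

lemma H_ground: "x \<in> H \<Longrightarrow> x \<in> E"
  using X_ground HX by blast

lemma flat_F: "flat F" and F_subset: "F \<subseteq> H" and F_neq: "F \<noteq> H"
  using flat_cl_colour_class[OF flat_H] cl_colour_class_subset[OF flat_H] not_span_H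
  by (auto simp: F_def spans_def)

lemma colour_notin_F: "x \<in> H \<Longrightarrow> x \<notin> F \<Longrightarrow> c x \<noteq> i"
  using mem_cl_colour_class[OF flat_H] by (auto simp: F_def)

lemma colour_cases: "x \<in> X \<Longrightarrow> c x = i \<or> c x = j \<or> c x = k"
  using colours(4) by blast

lemma off_H: "a \<in> H \<Longrightarrow> b \<in> E \<Longrightarrow> b \<notin> H \<Longrightarrow> b \<notin> cl {a}" "a \<in> H \<Longrightarrow> b \<in> E \<Longrightarrow> b \<notin> H \<Longrightarrow> a \<notin> cl {b}"
  "a \<in> H \<Longrightarrow> b \<in> E \<Longrightarrow> b \<notin> H \<Longrightarrow> cl {a} \<noteq> cl {b}"
  using in_flat_singleton[OF flat_H] cl_singleton_sym mem_cl_singleton by blast+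

lemma line_meets_H:
  assumes "a \<in> X" "a \<notin> H" "b \<in> X" "cl {a} \<noteq> cl {b}"
  obtains h where "h \<in> H" "h \<in> cl {a, b}"
proof -
  have "b \<in> cl (insert a H)" using hyperplane assms by blast
  then obtain h where h: "h \<in> H" "b \<in> cl {h, a}"
    using cl_insert_flat[OF flat_H H_nonempty, of a b] X_ground assms by blast
  have "b \<notin> cl {a}" using mem_cl_singleton_iff X_ground assms by blast
  then have "h \<in> cl {a, b}"
    using cl_pair_exchange[of b a h] h H_ground by (simp add: insert_commute)
  then show ?thesis using that h by blast
qed

text \<open>The points at infinity \<open>m\<close>, \<open>m'\<close> and \<open>h\<close> of the
  triangle \<open>s\<close>, \<open>s'\<close>, \<open>w\<close> are collinear. If \<open>m\<close>
  had colour \<open>i\<close> it would lie in \<open>F\<close>; then \<open>m'\<close> could not,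
  since \<open>h\<close> does not, so \<open>m'\<close> would have colour \<open>k\<close> and
  \<open>m\<close>, \<open>m'\<close>, \<open>h\<close> would be rainbow.\<close>

lemma direction_colour:
  assumes s: "s \<in> X" "s \<notin> H" "c s = i" and s': "s' \<in> X" "s' \<notin> H" "c s' = i"
    and h: "h \<in> H" "h \<notin> F" "c h = j" "h \<in> cl {s, s'}"
    and w: "w \<in> X" "w \<notin> H" "c w = k" "w \<notin> cl {s, s'}"
    and m: "m \<in> H" "m \<in> cl {s, w}" and m': "m' \<in> H" "m' \<in> cl {s', w}"
  shows "c m = k"
proof -
  have E: "s \<in> E" "s' \<in> E" "h \<in> E" "w \<in> E" "m \<in> E" "m' \<in> E"
    using X_ground H_ground s s' h w m m' by auto
  have sw: "cl {s} \<noteq> cl {w}" "cl {s'} \<noteq> cl {w}"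
    using mem_cl_singleton[of w] w E cl_mono[of "{s}" "{s, s'}"] cl_mono[of "{s'}" "{s, s'}"] by blast+
  have ik: "c m = i \<or> c m = k"
    using line_not_all_distinct[OF E(1,4) mem_cl_pair[OF E(1,4)] m(2)] sw(1) off_H(3)[OF m(1) E(1) s(2)]
      off_H(3)[OF m(1) E(4) w(2)] s(3) w(3) colours(2) by metis
  have ik': "c m' = i \<or> c m' = k"
    using line_not_all_distinct[OF E(2,4) mem_cl_pair[OF E(2,4)] m'(2)] sw(2) off_H(3)[OF m'(1) E(2) s'(2)]
      off_H(3)[OF m'(1) E(4) w(2)] s'(3) w(3) colours(2) by metis
  have hmm: "h \<in> cl {m, m'}"
  proof -
    have wmm: "{w, m, m'} \<subseteq> E" using E by auto
    have "s \<in> cl {w, m}" "s' \<in> cl {w, m'}"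
      using cl_pair_exchange[of m w s] cl_pair_exchange[of m' w s'] m m' E
        off_H(2)[OF m(1) E(4) w(2)] off_H(2)[OF m'(1) E(4) w(2)] by (auto simp: insert_commute)
    then have "{s, s'} \<subseteq> cl {w, m, m'}"
      using cl_mono[of "{w, m}" "{w, m, m'}"] cl_mono[of "{w, m'}" "{w, m, m'}"] by blast
    then have "h \<in> cl {w, m, m'}" using cl_trans[OF h(4) _ wmm] by blast
    then show ?thesis using flat_Int_cl_insert[OF flat_H, of "{m, m'}" w] m m' h E w by blast
  qed
  show ?thesis
  proof (rule ccontr)
    assume "c m \<noteq> k"
    then have mi: "c m = i" using ik by blast
    then have mF: "m \<in> F" using colour_notin_F m by blast
    then have m'F: "m' \<notin> F" using in_flat_pair[OF flat_F _ _ hmm] h by blast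
    then have m'k: "c m' = k" using ik' colour_notin_F m' by blast
    have off_F: "cl {m} \<noteq> cl {x}" if "x \<notin> F" "x \<in> E" for x
      using in_flat_singleton[OF flat_F mF] mem_cl_singleton that by blast
    have "cl {m'} \<noteq> cl {h}"
    proof
      assume eq: "cl {m'} = cl {h}"
      have "w \<in> cl {s', m'}"
        using cl_pair_exchange[OF m'(2) off_H(2)[OF m'(1) E(2) s'(2)] E(4)] .
      moreover have "m' \<in> cl {h}" using eq mem_cl_singleton E by blast
      then have "m' \<in> cl {s, s'}" using cl_trans[of m' "{h}" "{s, s'}"] h E by auto
      then have "{s', m'} \<subseteq> cl {s, s'}" using mem_cl_pair E by auto
      ultimately show False using cl_trans[of w "{s', m'}" "{s, s'}"] w E by auto
    qed
    then show False
      using line_not_all_distinct[OF E(5,6) mem_cl_pair[OF E(5,6)] hmm] off_F[OF m'F E(6)]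
        off_F[OF h(2) E(3)] mi m'k h(3) colours(1-3) by metis
  qed
qed

text \<open>Work in the plane \<open>?P\<close> of \<open>s\<close>, \<open>s'\<close>,
  \<open>w\<close>. Colour \<open>k\<close> spans it, so by the planar case colour \<open>i\<close>
  or \<open>j\<close> does not. The span \<open>?Q\<close> of that colour contains \<open>h\<close>
  but not \<open>w\<close>, so the line from \<open>h\<close> to \<open>w\<close> is monochromatic
  away from \<open>h\<close>.\<close>

lemma translate_colour:
  assumes s: "s \<in> X" "s \<notin> H" "c s = i" and s': "s' \<in> X" "s' \<notin> H" "c s' = i"
    and h: "h \<in> H" "h \<notin> F" "c h = j" "h \<in> cl {s, s'}"
    and w: "w \<in> X" "w \<notin> H" "c w = k"
    and z: "z \<in> cl {w, h}" "z \<notin> H"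
  shows "c z = k"
proof -
  have E: "s \<in> E" "s' \<in> E" "h \<in> E" "w \<in> E" "z \<in> E"
    using X_ground H_ground s s' h w z in_ground by auto
  have hs: "cl {h} \<noteq> cl {s}" "cl {h} \<noteq> cl {s'}" "cl {h} \<noteq> cl {w}"
    using off_H(3)[OF h(1)] E s s' w by auto
  have ss': "cl {s} \<noteq> cl {s'}"
  proof
    assume eq: "cl {s} = cl {s'}"
    then have "{s, s'} \<subseteq> cl {s}" using mem_cl_singleton E by auto
    then have "h \<in> cl {s}" using cl_trans[OF h(4)] E by simp
    then show False using off_H(2)[OF h(1) E(1) s(2)] by blast
  qed
  \<comment> \<open>On the line through \<open>s\<close> and \<open>s'\<close>, the elements
    \<open>h\<close> and \<open>w\<close> would be rainbow with \<open>s\<close>, or with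
    \<open>s'\<close> if \<open>w\<close> is parallel to \<open>s\<close>.\<close>
  have w_off: "w \<notin> cl {s, s'}"
  proof
    assume wl: "w \<in> cl {s, s'}"
    show False
    proof (cases "cl {w} = cl {s}")
      case False
      then show False
        using line_not_all_distinct[OF E(1,2) mem_cl_pair(1)[OF E(1,2)] h(4) wl] hs s(3) h(3) w(3)
          colours(1-3) by metis
    next
      case True
      then show False
        using line_not_all_distinct[OF E(1,2) mem_cl_pair(2)[OF E(1,2)] h(4) wl] hs s'(3) h(3) w(3) ss'
          colours(1-3) by metis
    qed
  qed
  have sw: "cl {s} \<noteq> cl {w}" "cl {s'} \<noteq> cl {w}"
    using mem_cl_singleton[of w] w_off E cl_mono[of "{s}" "{s, s'}"] cl_mono[of "{s'}" "{s, s'}"] by blast+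
  obtain m where m: "m \<in> H" "m \<in> cl {s, w}" using line_meets_H[OF s(1,2) w(1) sw(1)] .
  obtain m' where m': "m' \<in> H" "m' \<in> cl {s', w}" using line_meets_H[OF s'(1,2) w(1) sw(2)] .
  have mk: "c m = k" using direction_colour[OF s s' h w w_off m m'] .
  have "h \<in> cl {s', s}" "w \<notin> cl {s', s}" using h w_off by (auto simp: insert_commute)
  then have m'k: "c m' = k" using direction_colour[OF s' s h(1-3) _ w _ m' m] by blast
  let ?P = "cl {w, s, s'}"
  have wss: "{w, s, s'} \<subseteq> E" using E by auto
  have P: "flat ?P" using flat_cl[OF wss] .
  have PX: "?P \<subseteq> X" using cl_subset_flat[OF flat_X] w s s' by simp
  have inP: "w \<in> ?P" "s \<in> ?P" "s' \<in> ?P" using subset_cl[OF wss] by auto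
  have hP: "h \<in> ?P" using in_flat_pair[OF P inP(2,3) h(4)] .
  have mP: "m \<in> ?P" using in_flat_pair[OF P inP(2,1) m(2)] .
  have m'P: "m' \<in> ?P" using in_flat_pair[OF P inP(3,1) m'(2)] .
  have rank_P: "rank ?P = 3"
    using rank_insert[OF E(4) w_off] rank_cl[OF wss] rank_cl[of "{s, s'}"] rank_line[OF E(1,2) ss'] E
    by simp
  have span_if: "x \<in> Q" if Q: "flat Q" and "w \<in> Q" "s \<in> Q" "s' \<in> Q" "x \<in> ?P" for Q x
    using cl_subset_flat[OF Q, of "{w, s, s'}"] that by auto
  have sm: "s \<in> cl {w, m}" "s' \<in> cl {w, m'}"
    using cl_pair_exchange[of m w s] cl_pair_exchange[of m' w s'] m m' E
      off_H(2)[OF m(1) E(4) w(2)] off_H(2)[OF m'(1) E(4) w(2)] by (auto simp: insert_commute)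
  have "spans k ?P"
    unfolding spans_def
  proof
    let ?Q = "cl (colour_class k ?P)"
    show "?Q \<subseteq> ?P" using cl_colour_class_subset[OF P] .
    have Q: "flat ?Q" using flat_cl_colour_class[OF P] .
    have 1: "w \<in> ?Q" "m \<in> ?Q" "m' \<in> ?Q"
      using mem_cl_colour_class[OF P] inP mP m'P w mk m'k by auto
    then have "s \<in> ?Q" "s' \<in> ?Q" using in_flat_pair[OF Q 1(1)] sm by blast+
    then show "?P \<subseteq> ?Q" using span_if[OF Q 1(1)] by blast
  qed
  moreover have "c ` ?P \<subseteq> {i, j, k}" using PX colours(4) by blast
  ultimately have "\<not> spans i ?P \<or> \<not> spans j ?P"
    using not_all_span_plane[OF P rank_P colours(1-3)] by blast
  then obtain l where l: "l = i \<or> l = j" "\<not> spans l ?P" by blast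
  let ?Q = "cl (colour_class l ?P)"
  have Q: "flat ?Q" using flat_cl_colour_class[OF P] .
  have QP: "?Q \<subseteq> ?P" "?Q \<noteq> ?P" using cl_colour_class_subset[OF P] l by (auto simp: spans_def)
  \<comment> \<open>If the colour is \<open>i\<close>, then \<open>?Q\<close> contains
    \<open>s\<close> and \<open>s'\<close> and thus \<open>h\<close>; if it is \<open>j\<close>,
    then \<open>h\<close> itself has that colour.\<close>
  have hQ: "h \<in> ?Q"
    using l(1)
  proof
    assume "l = i"
    then have "s \<in> ?Q" "s' \<in> ?Q" using mem_cl_colour_class[OF P] inP s(3) s'(3) by auto
    then show ?thesis using in_flat_pair[OF Q _ _ h(4)] by blast
  next
    assume "l = j"
    then show ?thesis using mem_cl_colour_class[OF P hP] h by auto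
  qed
  \<comment> \<open>If \<open>w\<close> were in \<open>?Q\<close>, then \<open>s\<close> could not
    be, as \<open>s\<close>, \<open>h\<close>, \<open>w\<close> span the plane. The line from
    \<open>w\<close> to \<open>s\<close> would then be monochromatic away from \<open>w\<close>, but
    \<open>m\<close> and \<open>s\<close> differ in colour.\<close>
  have wQ: "w \<notin> ?Q"
  proof
    assume wQ: "w \<in> ?Q"
    have sQ: "s \<notin> ?Q"
    proof
      assume sQ: "s \<in> ?Q"
      have "h \<notin> cl {s}" using off_H(2)[OF h(1) E(1) s(2)] .
      then have "s' \<in> ?Q" using flat_pair_exchange[OF Q sQ hQ _ h(4)] E by blast
      then show False using span_if[OF Q wQ sQ] QP by blast
    qed
    have "m \<in> cl {w, s}" using m by (simp add: insert_commute)
    then have "c m = c s"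
      using line_to_span[OF P refl wQ inP(2) sQ] off_H(2)[OF m(1) E(4) w(2)] by blast
    then show False using mk s colours by simp
  qed
  have "z \<in> cl {h, w}" using z by (simp add: insert_commute)
  then have "c z = c w"
    using line_to_span[OF P refl hQ inP(1) wQ] off_H(1)[OF h(1) E(5) z(2)] by blast
  then show ?thesis using w by simp
qed

text \<open>\<open>N l\<close>: elements off \<open>H\<close> that become parallel to an element of colour \<open>l\<close> when \<open>F\<close> is
  contracted. \<open>G l\<close>: points at infinity (with respect to \<open>H\<close>) in whose direction \<open>N l\<close> is closed
  under translation.\<close>

definition N :: "'c \<Rightarrow> 'a set" where
  "N l = {y \<in> X - H. \<exists>w\<in>cl (insert y F) - H. c w = l}"

definition G :: "'c \<Rightarrow> 'a set" where
  "G l = {d \<in> H. \<forall>y\<in>N l. \<forall>z\<in>cl {y, d} - H. z \<in> N l}"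

lemma FE: "F \<subseteq> E"
  using F_subset H_ground by blast

text \<open>By exchange, lying in a common span with \<open>F\<close> is an equivalence relation off
  \<open>H\<close>: parallelism after contracting \<open>F\<close>.\<close>

lemma cl_insert_F:
  assumes "y \<in> X" "w \<in> cl (insert y F)" "w \<notin> H"
  shows "w \<in> X" "y \<in> cl (insert w F)" "cl (insert w F) = cl (insert y F)"
proof -
  have yE: "y \<in> E" using X_ground assms by blast
  have wE: "w \<in> E" using assms in_ground by blast
  show "w \<in> X"
    using cl_subset_flat[OF flat_X, of "insert y F"] F_subset HX assms by auto
  have "w \<notin> cl F" using flat_cl_eq[OF flat_F] F_subset assms by blast
  then show y: "y \<in> cl (insert w F)" using cl_exchange[of y w F] yE assms by blast
  show "cl (insert w F) = cl (insert y F)"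
  proof
    have "insert w F \<subseteq> cl (insert y F)" using subset_cl[of "insert y F"] yE FE assms by auto
    then show "cl (insert w F) \<subseteq> cl (insert y F)"
      using cl_subset_iff[of "insert w F" "insert y F"] wE yE FE by auto
    have "insert y F \<subseteq> cl (insert w F)" using subset_cl[of "insert w F"] wE FE y by auto
    then show "cl (insert y F) \<subseteq> cl (insert w F)"
      using cl_subset_iff[of "insert y F" "insert w F"] wE yE FE by auto
  qed
qed

lemma N_I:
  assumes "y \<in> N l" "z \<in> cl (insert y F)" "z \<notin> H"
  shows "z \<in> N l"
  using assms cl_insert_F[of y z] by (auto simp: N_def)

text \<open>Translation along \<open>e\<close> on the line through \<open>d\<close> and
  \<open>d'\<close> splits, by Veblen, into a translation along \<open>d\<close> followed by one
  along \<open>d'\<close>.\<close>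

lemma flat_G: "flat (G l)"
proof (rule flat_if_line_closed)
  show "G l \<subseteq> E" using H_ground by (auto simp: G_def)
next
  fix d d' e assume d: "d \<in> G l" "d' \<in> G l" "e \<in> cl {d, d'}"
  then have dH: "d \<in> H" "d' \<in> H" by (auto simp: G_def)
  have eH: "e \<in> H" using in_flat_pair[OF flat_H dH d(3)] .
  have E: "d \<in> E" "d' \<in> E" "e \<in> E" using dH eH H_ground by auto
  have "z \<in> N l" if y: "y \<in> N l" and z: "z \<in> cl {y, e}" "z \<notin> H" for y z
  proof -
    have yE: "y \<in> E" using y X_ground by (auto simp: N_def)
    have S: "{d', y, d} \<subseteq> E" using E yE by auto
    have "e \<in> cl {d', y, d}" using d(3) cl_mono[of "{d, d'}" "{d', y, d}"] by blast
    then have "{y, e} \<subseteq> cl {d', y, d}" using subset_cl[OF S] by auto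
    then have "z \<in> cl {d', y, d}" using cl_trans[OF z(1) _ S] by blast
    then obtain t where t: "t \<in> cl {y, d}" "z \<in> cl {t, d'}"
      using veblen[OF yE E(1,2)] by blast
    have "t \<notin> H" using in_flat_pair[OF flat_H _ dH(2) t(2)] z by blast
    then have "t \<in> N l" using d(1) y t by (auto simp: G_def)
    then show ?thesis using d(2) t z by (auto simp: G_def)
  qed
  then show "e \<in> G l" using eH by (auto simp: G_def)
qed

lemma F_subset_G: "F \<subseteq> G l"
proof
  fix f assume f: "f \<in> F"
  have "z \<in> N l" if y: "y \<in> N l" and z: "z \<in> cl {y, f}" "z \<notin> H" for y z
    using N_I[OF y _ z(2)] cl_mono[of "{y, f}" "insert y F"] f z by blast
  then show "f \<in> G l" using f F_subset by (auto simp: G_def)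
qed

text \<open>This lifts \<open>translate_colour\<close> to classes modulo \<open>F\<close>:
  translating \<open>y\<close> along \<open>h\<close> agrees, modulo \<open>F\<close>, with
  translating its representative \<open>w\<close> of colour \<open>k\<close> along
  \<open>h\<close>.\<close>

lemma direction_in_G:
  assumes s: "s \<in> X" "s \<notin> H" "c s = i" and s': "s' \<in> X" "s' \<notin> H" "c s' = i"
    and h: "h \<in> H" "h \<notin> F" "c h = j" "h \<in> cl {s, s'}"
  shows "h \<in> G k"
proof -
  have "z \<in> N k" if y: "y \<in> N k" and z: "z \<in> cl {y, h}" "z \<notin> H" for y z
  proof -
    have yX: "y \<in> X" "y \<notin> H" using y by (auto simp: N_def)
    obtain w where w: "w \<in> cl (insert y F)" "w \<notin> H" "c w = k" using y by (auto simp: N_def)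
    note wF = cl_insert_F[OF yX(1) w(1,2)]
    have E: "w \<in> E" "y \<in> E" "h \<in> E" "z \<in> E" using wF yX h z in_ground X_ground H_ground by auto
    have zX: "z \<in> X" using in_flat_pair[OF flat_X yX(1) _ z(1)] h HX by blast
    have tr: "c u = k" if "u \<in> cl {w, h}" "u \<notin> H" for u
      using translate_colour[OF s s' h wF(1) w(2,3) that] .
    have "\<exists>u. u \<in> cl {w, h} \<and> u \<notin> H \<and> u \<in> cl (insert z F)"
    \<comment> \<open>The case is separate because \<open>cl_insert_flat\<close> applies only to
      nonempty flats; here parallel modulo \<open>F\<close> is plain parallelism.\<close>
    proof (cases "F = {}")
      case True
      then have "cl {w} = cl {y}" using wF(3) by simp
      then have "{y, h} \<subseteq> cl {w, h}"
        using mem_cl_singleton[OF E(2)] mem_cl_pair(2)[OF E(1,3)] cl_mono[of "{w}" "{w, h}"] by auto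
      then have "z \<in> cl {w, h}" using cl_trans[OF z(1)] E by auto
      moreover have "z \<in> cl (insert z F)" using True mem_cl_singleton[OF E(4)] by simp
      ultimately show ?thesis using z by blast
    next
      case False
      have hF: "insert h F \<subseteq> E" using E FE by auto
      have S: "insert w (cl (insert h F)) \<subseteq> E" using E cl_ground by auto
      have "insert y F \<subseteq> cl (insert w F)" using wF subset_cl[of "insert w F"] E FE by auto
      then have "{y, h} \<subseteq> cl (insert w (cl (insert h F)))"
        using cl_mono[of "insert w F" "insert w (cl (insert h F))"] subset_cl[OF hF] subset_cl[OF S] by blast
      then have "z \<in> cl (insert w (cl (insert h F)))" using cl_trans[OF z(1) _ S] by blast
      moreover have "cl (insert h F) \<noteq> {}" using subset_cl[OF hF] by auto
      ultimately obtain a where a: "a \<in> cl (insert h F)" "z \<in> cl {a, w}"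
        using cl_insert_flat[OF flat_cl[OF hF]] E by blast
      obtain f where f: "f \<in> F" "a \<in> cl {f, h}" using cl_insert_flat[OF flat_F False E(3) a(1)] .
      have fE: "f \<in> E" using f FE by blast
      have T: "{f, w, h} \<subseteq> E" using E fE by auto
      have "{a, w} \<subseteq> cl {f, w, h}"
        using f cl_mono[of "{f, h}" "{f, w, h}"] subset_cl[OF T] by blast
      then have "z \<in> cl {f, w, h}" using cl_trans[OF a(2) _ T] by blast
      \<comment> \<open>Projecting \<open>z\<close> from \<open>f\<close> onto the line through
        \<open>w\<close> and \<open>h\<close> gives the required translate \<open>u\<close> of
        \<open>w\<close>.\<close>
      then obtain u where u: "u \<in> cl {w, h}" "z \<in> cl {u, f}" using veblen[OF E(1,3) fE] by blast
      have uE: "u \<in> E" using u in_ground by blast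
      have "u \<notin> H" using in_flat_pair[OF flat_H _ _ u(2)] f F_subset z by blast
      moreover have "z \<in> cl {f, u}" using u by (simp add: insert_commute)
      then have "u \<in> cl {f, z}"
        using cl_pair_exchange[of z f u] off_H(1)[of f z] f F_subset E z uE by blast
      then have "u \<in> cl (insert z F)" using cl_mono[of "{f, z}" "insert z F"] f by blast
      ultimately show ?thesis using u by blast
    qed
    then show ?thesis using tr zX z by (auto simp: N_def)
  qed
  then show ?thesis using h by (auto simp: G_def)
qed

section \<open>Separation of \<open>N j\<close> from \<open>N k\<close>, and generation of
  \<open>H\<close> by directions\<close>

lemma colour_point_off_H:
  assumes "spans l X"
  obtains x where "x \<in> X" "x \<notin> H" "c x = l"
proof -
  have "H \<noteq> X" using not_span_H all_span by auto
  then show ?thesis using spans_not_subset[OF assms flat_H HX] that by blast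
qed

text \<open>Join parallel elements \<open>w\<close>, \<open>w'\<close> of colours \<open>j\<close>,
  \<open>k\<close> to an \<open>i\<close>-element \<open>s\<close> outside their span with
  \<open>F\<close>. The points at infinity \<open>h\<close>, \<open>h'\<close> of these lines
  inherit the colours \<open>j\<close>, \<open>k\<close>, yet they agree modulo \<open>F\<close>,
  and inside \<open>H\<close> lines through \<open>F\<close> preserve colour.\<close>

lemma N_disjoint: "N j \<inter> N k = {}"
proof (rule ccontr)
  assume "N j \<inter> N k \<noteq> {}"
  then obtain y where y: "y \<in> X" "y \<notin> H" "y \<in> N j" "y \<in> N k" by (auto simp: N_def)
  obtain w where w: "w \<in> cl (insert y F)" "w \<notin> H" "c w = j" using y by (auto simp: N_def)
  obtain w' where w': "w' \<in> cl (insert y F)" "w' \<notin> H" "c w' = k" using y by (auto simp: N_def)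
  note wF = cl_insert_F[OF y(1) w(1,2)] and w'F = cl_insert_F[OF y(1) w'(1,2)]
  let ?Y = "cl (insert y F)"
  have yF: "insert y F \<subseteq> E" using y X_ground FE by auto
  have Y: "flat ?Y" using flat_cl[OF yF] .
  have YX: "?Y \<subseteq> X" using cl_subset_flat[OF flat_X, of "insert y F"] y F_subset HX by auto
  have FY: "F \<subseteq> ?Y" using subset_cl[OF yF] by auto
  have HY: "H \<inter> ?Y \<subseteq> F"
    using flat_Int_cl_insert[OF flat_H F_subset, of y] y X_ground flat_cl_eq[OF flat_F] by auto
  then have "?Y \<noteq> X" using F_subset F_neq HX by blast
  then obtain s where s: "s \<in> X" "c s = i" "s \<notin> ?Y" using spans_not_subset[OF all_span(1) Y YX] by blast
  have sH: "s \<notin> H" using mem_cl_colour_class[OF flat_H, of s i] s FY by (auto simp: F_def)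
  have E: "s \<in> E" "w \<in> E" "w' \<in> E" using s wF w'F X_ground by auto
  have dir: "\<exists>h\<in>H. h \<in> cl {s, v} \<and> h \<notin> F \<and> c h = c v" if v: "v \<in> ?Y" "v \<notin> H" "v \<in> X" "c v \<noteq> i" for v
  proof -
    have vE: "v \<in> E" using v X_ground by blast
    have sv: "cl {s} \<noteq> cl {v}" using in_flat_singleton[OF Y v(1)] s mem_cl_singleton[OF E(1)] by blast
    obtain h where h: "h \<in> H" "h \<in> cl {s, v}" using line_meets_H[OF s(1) sH v(3) sv] .
    have "h \<in> cl {v, s}" using h by (simp add: insert_commute)
    then have hY: "h \<notin> ?Y"
      using flat_pair_exchange[OF Y v(1) _ off_H(2)[OF h(1) vE v(2)]] E s by blast
    then have hF: "h \<notin> F" using FY by blast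
    have "c h \<noteq> i" using colour_notin_F[OF h(1) hF] .
    then have "c h = c v"
      using line_not_all_distinct[OF E(1) vE mem_cl_pair[OF E(1) vE] h(2)] sv off_H(3)[OF h(1) E(1) sH]
        off_H(3)[OF h(1) vE v(2)] s(2) v(4) by metis
    then show ?thesis using h hF by blast
  qed
  obtain h where h: "h \<in> H" "h \<in> cl {s, w}" "h \<notin> F" "c h = j"
    using dir[OF w(1,2) wF(1)] w(3) colours by auto
  obtain h' where h': "h' \<in> H" "h' \<in> cl {s, w'}" "h' \<notin> F" "c h' = k"
    using dir[OF w'(1,2) w'F(1)] w'(3) colours by auto
  have hE: "h \<in> E" "h' \<in> E" using h h' H_ground by auto
  show False
  proof (cases "F = {}")
    case True
    then have "cl {w} = cl {w'}" using wF(3) w'F(3) by simp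
    then have "{s, w'} \<subseteq> cl {s, w}"
      using mem_cl_singleton[OF E(3)] cl_mono[of "{w}" "{s, w}"] mem_cl_pair[OF E(1,2)] by auto
    then have "h' \<in> cl {s, w}" using cl_trans[OF h'(2)] E by auto
    moreover have "cl {s} \<noteq> cl {w}"
      using in_flat_singleton[OF Y w(1)] s mem_cl_singleton[OF E(1)] by blast
    ultimately show False
      using line_not_all_distinct[OF E(1,2) mem_cl_pair[OF E(1,2)], of h']
        off_H(3)[OF h'(1) E(1) sH] off_H(3)[OF h'(1) E(2) w(2)] s(2) w(3) h'(4) colours(1-3) by metis
  next
    case False
    have hF: "insert h F \<subseteq> E" "insert w (insert h F) \<subseteq> E" using E hE FE by auto
    have "w' \<in> cl (insert w F)" using wF(3) w' by simp
    then have 1: "w' \<in> cl (insert w (insert h F))"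
      using cl_mono[of "insert w F" "insert w (insert h F)"] by blast
    have "h \<in> cl {w, s}" using h by (simp add: insert_commute)
    then have "s \<in> cl {w, h}" using cl_pair_exchange[OF _ off_H(2)[OF h(1) E(2) w(2)] E(1)] by blast
    then have "s \<in> cl (insert w (insert h F))"
      using cl_mono[of "{w, h}" "insert w (insert h F)"] by blast
    then have "{s, w'} \<subseteq> cl (insert w (insert h F))" using 1 by blast
    then have "h' \<in> cl (insert w (insert h F))" using cl_trans[OF h'(2) _ hF(2)] by blast
    \<comment> \<open>All of this lies over \<open>F\<close>, \<open>h\<close> and \<open>w\<close>;
      intersecting with \<open>H\<close> removes \<open>w\<close>.\<close>
    then have "h' \<in> cl (insert h F)"
      using flat_Int_cl_insert[OF flat_H, of "insert h F" w] h h' F_subset E w by blast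
    then obtain f where f: "f \<in> F" "h' \<in> cl {f, h}" using cl_insert_flat[OF flat_F False hE(1)] by blast
    have "h' \<notin> cl {f}" using in_flat_singleton[OF flat_F f(1)] h' by blast
    then have "c h' = c h"
      using line_to_span[OF flat_H F_def f(1) h(1,3) f(2)] by blast
    then show False using h h' colours by simp
  qed
qed

text \<open>Colour \<open>i\<close> spans \<open>X\<close>. Seen from one \<open>i\<close>-element
  \<open>s\<close> off \<open>H\<close>, any other lies in \<open>F\<close> or has a direction in
  \<open>F\<close>, of colour \<open>j\<close> or of colour \<open>k\<close>. A direction of colour
  \<open>j\<close> lies in \<open>G k\<close> and one of colour \<open>k\<close> in
  \<open>G j\<close>, so \<open>s\<close> and these flats span \<open>X\<close>; intersecting with
  \<open>H\<close> removes \<open>s\<close>.\<close>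

lemma cl_G_union: "H \<subseteq> cl (G j \<union> G k)"
proof -
  let ?B = "cl (G j \<union> G k)"
  have GE: "G j \<union> G k \<subseteq> E" using flat_G flat_subset by blast
  have GH: "G j \<union> G k \<subseteq> H" by (auto simp: G_def)
  have BH: "?B \<subseteq> H" using cl_subset_flat[OF flat_H GH] .
  have B: "flat ?B" using flat_cl[OF GE] .
  have GB: "G j \<subseteq> ?B" "G k \<subseteq> ?B" using subset_cl[OF GE] by auto
  obtain s where s: "s \<in> X" "s \<notin> H" "c s = i" using colour_point_off_H[OF all_span(1)] .
  have sE: "s \<in> E" using s X_ground by blast
  let ?Z = "cl (insert s ?B)"
  have sB: "insert s ?B \<subseteq> E" using sE cl_ground by auto
  have Z: "flat ?Z" using flat_cl[OF sB] .
  have BZ: "s \<in> ?Z" "?B \<subseteq> ?Z" using subset_cl[OF sB] by auto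
  have "colour_class i X \<subseteq> ?Z"
  proof
    fix a assume "a \<in> colour_class i X"
    then have a: "a \<in> X" "c a = i" by (auto simp: colour_class_def)
    show "a \<in> ?Z"
    proof (cases "a \<in> H")
      case True
      then have "a \<in> F" using colour_notin_F a by blast
      then show ?thesis using F_subset_G[of j] GB BZ by blast
    next
      case aH: False
      have aE: "a \<in> E" using a X_ground by blast
      show ?thesis
      proof (cases "cl {s} = cl {a}")
        case True
        then show ?thesis using in_flat_singleton[OF Z BZ(1)] mem_cl_singleton[OF aE] by blast
      next
        case False
        obtain h where h: "h \<in> H" "h \<in> cl {s, a}" using line_meets_H[OF s(1,2) a(1) False] .
        have "h \<in> ?B"
        proof (cases "h \<in> F")
          case True
          then show ?thesis using F_subset_G[of j] GB by blast
        next
          case hF: False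
          have "c h = j \<or> c h = k" using colour_cases colour_notin_F[OF h(1) hF] h HX by blast
          then have "h \<in> G k \<or> h \<in> G j"
            using direction_in_G[OF s a(1) aH a(2) h(1) hF _ h(2)]
              spanned_extension.direction_in_G[OF swap s a(1) aH a(2) h(1) hF _ h(2)] by blast
          then show ?thesis using GB by blast
        qed
        then have "h \<in> ?Z" using BZ by blast
        then show ?thesis
          using flat_pair_exchange[OF Z BZ(1) _ off_H(2)[OF h(1) sE s(2)] h(2) aE] by blast
      qed
    qed
  qed
  then have "X \<subseteq> ?Z" using cl_subset_flat[OF Z] all_span(1) by (auto simp: spans_def)
  then have "H \<subseteq> H \<inter> ?Z" using HX by blast
  also have "\<dots> \<subseteq> cl ?B" using flat_Int_cl_insert[OF flat_H BH sE s(2)] .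
  finally show ?thesis using flat_cl_eq[OF B] by simp
qed

text \<open>Split the direction from \<open>w\<close> to \<open>w'\<close> into a part
  \<open>v\<close> in \<open>G j\<close> and a part \<open>u\<close> in \<open>G k\<close>. Moving
  \<open>w\<close> along \<open>v\<close> and \<open>w'\<close> along \<open>u\<close> leads to a
  common element \<open>t\<close> of \<open>N j\<close> and \<open>N k\<close>.\<close>

lemma contradiction: False
proof -
  obtain w where w: "w \<in> X" "w \<notin> H" "c w = j" using colour_point_off_H[OF all_span(2)] .
  obtain w' where w': "w' \<in> X" "w' \<notin> H" "c w' = k" using colour_point_off_H[OF all_span(3)] .
  have E: "w \<in> E" "w' \<in> E" using w w' X_ground by auto
  have self: "x \<in> cl (insert x F)" if "x \<in> E" for x using subset_cl[of "insert x F"] FE that by auto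
  have wN: "w \<in> N j" "w' \<in> N k" using w w' self E by (auto simp: N_def)
  have move: "z \<in> N l" if "y \<in> N l" "d \<in> G l" "z \<in> cl {y, d}" "z \<notin> H" for y d z l
    using that by (auto simp: G_def)
  have GH: "G l \<subseteq> H" for l by (auto simp: G_def)
  have ww': "cl {w} \<noteq> cl {w'}"
  proof
    assume "cl {w} = cl {w'}"
    then have "w' \<in> cl (insert w F)"
      using mem_cl_singleton[OF E(2)] cl_mono[of "{w}" "insert w F"] by blast
    then have "w' \<in> N j" using N_I[OF wN(1)] w' by blast
    then show False using wN N_disjoint by blast
  qed
  obtain h where h: "h \<in> H" "h \<in> cl {w, w'}" using line_meets_H[OF w(1,2) w'(1) ww'] .
  have hE: "h \<in> E" using h H_ground by blast
  have w'h: "w' \<in> cl {w, h}" using cl_pair_exchange[OF h(2) off_H(2)[OF h(1) E(1) w(2)] E(2)] .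
  have "h \<in> cl {w', w}" using h by (simp add: insert_commute)
  then have wh: "w \<in> cl {w', h}" using cl_pair_exchange[OF _ off_H(2)[OF h(1) E(2) w'(2)] E(1)] by blast
  have GE: "G j \<union> G k \<subseteq> E" using flat_G flat_subset by blast
  \<comment> \<open>Joining two flats by lines needs both nonempty. If one were empty, the other
    would contain \<open>h\<close>, and a single translation would identify \<open>w\<close> with
    \<open>w'\<close> in \<open>N j\<close> or \<open>N k\<close>.\<close>
  have "h \<notin> G j" using move[OF wN(1) _ w'h w'(2)] wN N_disjoint by blast
  moreover have "h \<notin> G k" using move[OF wN(2) _ wh w(2)] wN N_disjoint by blast
  moreover have "h \<in> cl (G j \<union> G k)" using cl_G_union h by blast
  moreover have "cl (G j \<union> G k) = G j" if "G k = {}" using flat_cl_eq[OF flat_G] that by simp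
  moreover have "cl (G j \<union> G k) = G k" if "G j = {}" using flat_cl_eq[OF flat_G] that by simp
  ultimately have "G j \<noteq> {}" "G k \<noteq> {}" by auto
  then obtain v u where vu: "v \<in> G j" "u \<in> G k" "h \<in> cl {v, u}"
    using cl_Un_flats[OF flat_G _ flat_G] \<open>h \<in> cl (G j \<union> G k)\<close> by blast
  have uE: "u \<in> E" "v \<in> E" using vu GE by auto
  have uH: "u \<in> H" using vu GH by blast
  have S: "{u, w, v} \<subseteq> E" using uE E by auto
  have "{w, h} \<subseteq> cl {u, w, v}"
    using vu(3) cl_mono[of "{v, u}" "{u, w, v}"] subset_cl[OF S] by blast
  then have "w' \<in> cl {u, w, v}" using cl_trans[OF w'h _ S] by blast
  then obtain t where t: "t \<in> cl {w, v}" "w' \<in> cl {t, u}" using veblen[OF E(1) uE(2,1)] by blast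
  have tE: "t \<in> E" using t in_ground by blast
  have tH: "t \<notin> H" using in_flat_pair[OF flat_H _ uH t(2)] w' by blast
  have "w' \<in> cl {u, t}" using t by (simp add: insert_commute)
  then have "t \<in> cl {u, w'}" using cl_pair_exchange[OF _ off_H(1)[OF uH E(2) w'(2)] tE] by blast
  then have "t \<in> cl {w', u}" by (simp add: insert_commute)
  then have "t \<in> N k" using move[OF wN(2) vu(2) _ tH] by blast
  moreover have "t \<in> N j" using move[OF wN(1) vu(1) t(1) tH] .
  ultimately show False using N_disjoint by blast
qed

end

section \<open>Induction on rank and reduction to three colours\<close>

context rainbow_free_matroid
begin

text \<open>Lines are settled directly. In higher rank, dropping a basis element gives a hyperplane
  that some colour fails to span, and that colour takes the role of \<open>i\<close> in
  \<open>spanned_extension\<close>. The planar count enters only through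
  \<open>translate_colour\<close>.\<close>

lemma not_all_span:
  assumes "flat X" "2 \<le> rank X" "i \<noteq> j" "i \<noteq> k" "j \<noteq> k" "c ` X \<subseteq> {i, j, k}"
  shows "\<not> (spans i X \<and> spans j X \<and> spans k X)"
  using assms
proof (induction "rank X" arbitrary: X rule: less_induct)
  case less
  have X: "flat X" "X \<subseteq> E" using less.prems flat_subset by auto
  obtain B where B: "B \<subseteq> X" "indep B" "card B = rank X" by (rule basis_exists)
  have "B \<noteq> {}" using B less.prems by auto
  then obtain e where e: "e \<in> B" by blast
  let ?H = "cl (B - {e})"
  have BE: "B - {e} \<subseteq> E" using B X by auto
  have H: "flat ?H" using flat_cl[OF BE] .
  have HX: "?H \<subseteq> X" using cl_subset_flat[OF X(1), of "B - {e}"] B by auto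
  have "card (B - {e}) = rank X - 1" using B e by simp
  then have rank_H: "rank ?H = rank X - 1"
    using rank_cl[OF BE] card_eq_rank[of "B - {e}"] indep_subset[OF B(2)] by simp
  have hyper: "X \<subseteq> cl (insert x ?H)" if x: "x \<in> X - ?H" for x
  proof -
    have "rank (insert x ?H) = rank X"
      using rank_insert[of x ?H] x X flat_cl_eq[OF H] rank_H less.prems(2) by auto
    then have "cl (insert x ?H) = cl X"
      using cl_eq_if_rank_eq[of "insert x ?H" X] x HX X by simp
    then show ?thesis using flat_cl_eq[OF X(1)] by simp
  qed
  show ?case
  proof (cases "rank X = 2")
    case True
    then have "rank ?H = 1" using rank_H by simp
    then have "?H \<noteq> {}" using rank_empty by auto
    then obtain x where x: "x \<in> ?H" by blast
    have "e \<notin> ?H" using indep_not_cl[OF B(2) e] .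
    have E: "x \<in> E" "e \<in> E" using x in_ground e B X by auto
    have ex: "cl {x} \<noteq> cl {e}"
      using in_flat_singleton[OF H x] mem_cl_singleton[OF E(2)] \<open>e \<notin> ?H\<close> by blast
    have "cl {x, e} \<subseteq> X" using cl_subset_flat[OF X(1), of "{x, e}"] x HX e B by auto
    moreover have "rank (cl {x, e}) = rank X" using rank_line[OF E ex] True by simp
    ultimately have "cl {x, e} = X"
      using cl_eq_if_rank_eq[of "cl {x, e}" X] X flat_cl_eq[OF X(1)] cl_idem[of "{x, e}"] E by simp
    then show ?thesis using not_all_span_line[OF E less.prems(3-5) _ ex] less.prems(6) by blast
  next
    case False
    then have rH: "2 \<le> rank ?H" "rank ?H < rank X" using rank_H less.prems(2) by auto
    then have ne: "?H \<noteq> {}" using rank_empty by auto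
    have "c ` ?H \<subseteq> {i, j, k}" using HX less.prems(6) by blast
    then have not_H: "\<not> (spans i ?H \<and> spans j ?H \<and> spans k ?H)"
      using less.hyps[OF rH(2) H rH(1) less.prems(3-5)] by blast
    show ?thesis
    proof
      assume sp: "spans i X \<and> spans j X \<and> spans k X"
      consider "\<not> spans i ?H" | "\<not> spans j ?H" | "\<not> spans k ?H" using not_H by blast
      then show False
      proof cases
        case 1
        then have "spanned_extension E indep c X ?H i j k"
          using X H HX ne hyper sp less.prems by unfold_locales auto
        then show ?thesis by (rule spanned_extension.contradiction)
      next
        case 2
        then have "spanned_extension E indep c X ?H j i k"
          using X H HX ne hyper sp less.prems by unfold_locales auto
        then show ?thesis by (rule spanned_extension.contradiction)
      next
        case 3
        then have "spanned_extension E indep c X ?H k i j"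
          using X H HX ne hyper sp less.prems by unfold_locales auto
        then show ?thesis by (rule spanned_extension.contradiction)
      qed
    qed
  qed
qed

text \<open>With all colours except \<open>i\<close> and \<open>j\<close> merged into
  \<open>k\<close>, some merged class does not span, and neither does the original class of that
  colour inside it.\<close>

lemma decomposer_exists:
  assumes "3 \<le> num_colours c"
  shows "\<exists>F. F \<noteq> {} \<and> decomposer c F"
proof -
  have "\<exists>S \<subseteq> c ` E. card S = 3"
    using obtain_subset_with_card_n[OF assms[unfolded num_colours_def]] by metis
  then obtain i j k where ijk: "{i, j, k} \<subseteq> c ` E" "i \<noteq> j" "i \<noteq> k" "j \<noteq> k"
    by (auto simp: card_3_iff)
  \<comment> \<open>Merging colours creates no rainbow triangle and only enlarges colour classes.\<close>
  define g where "g x = (if x = i \<or> x = j then x else k)" for x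
  interpret m: rainbow_free_matroid E indep "g \<circ> c"
  proof
    show "\<not> (\<exists>T. rainbow_triangle (g \<circ> c) T)"
      using no_rainbow inj_on_imageI2 by (auto simp: rainbow_triangle_def)
  qed
  have E: "flat E" using cl_ground[of E] subset_cl[of E] by (auto simp: flat_def)
  have "(g \<circ> c) ` E \<subseteq> {i, j, k}" by (auto simp: g_def)
  then have "\<not> (m.spans i E \<and> m.spans j E \<and> m.spans k E)"
    using m.not_all_span[OF E rank_ge_2 ijk(2-4)] by blast
  then obtain l where l: "l \<in> {i, j, k}" "\<not> m.spans l E" by blast
  have "\<not> spans l E"
  proof
    assume "spans l E"
    moreover have "colour_class l E \<subseteq> m.colour_class l E"
      using l(1) ijk(2-4) by (auto simp: colour_class_def m.colour_class_def g_def)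
    ultimately have "E \<subseteq> cl (m.colour_class l E)" 
      using cl_mono[of "colour_class l E" "m.colour_class l E"] by (simp add: spans_def)
    then have "m.spans l E" using cl_ground by (auto simp: m.spans_def)
    then show False using l by simp
  qed
  then show ?thesis using decomposer_cl_colour_class[of l] l ijk by blast
qed

end

theorem theorem5p9:
  fixes E :: "'a set"
    and indep :: "'a set \<Rightarrow> bool"
    and c :: "'a \<Rightarrow> 'c"
  assumes "matroid E indep"
    and "matroid.connected E indep"
    and "matroid.modular E indep"
    and "\<not> (\<exists>T. matroid.rainbow_triangle E indep c T)"
    and "matroid.rank indep E \<ge> 2"
    and "matroid.num_colours E c \<ge> 3"
  shows "\<exists>F. F \<noteq> {} \<and> matroid.decomposer E indep c F"
proof -
  interpret matroid E indep by fact
  interpret rainbow_free_matroid E indep c using assms by unfold_locales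
  show ?thesis using decomposer_exists assms(6) by blast
qed

end
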